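(* Let $\mu\in\mathscr{P}([0,1]\times\mathbb{P})$. Then there exists $X_0\in\mathbb{P}$ such that $$\lim_{t\to0+}L_t(\mu)=X_0$$ in the strong operator topology.
   Context: $E$ is a (possibly infinite-dimensional) complex Hilbert space, $S(E)$ the Banach space of bounded self-adjoint operators, and $\mathbb{P}\subseteq S(E)$ the cone of positive definite operators, $\mathbb{P}=\bigcup_{k\ge1}\{X\in S(E):\frac1kI\le X\le kI\}$, with the norm topology; $A\le B$ means $B-A$ is positive semidefinite. $\mathscr{P}([0,1]\times\mathbb{P})$ is the set of Borel probability measures $\mu$ on $[0,1]\times\mathbb{P}$ with bounded support: $\mu(\operatorname{supp}\mu)=1$ and $\operatorname{supp}\mu\subseteq[0,1]\times\{A:e^{-r}I\le A\le e^rI\}$ for some $r<\infty$. Operator-valued integrals are weak operator Pettis integrals: $\int g\,d\mu$ is the $T\in S(E)$ with $\langle Tx,y\rangle=\int\langle gx,y\rangle d\mu$ for all $x,y\in E$. For $s,t\in[0,1]$, $x>0$ let $$f_{s,t}(x)=\frac{[(1-t)(1-s)+t]x+s(1-t)}{(1-t)(1-s)x+t+s(1-t)},\qquad M_{s,t}(X,A)=X^{1/2}f_{s,t}(X^{-1/2}AX^{-1/2})X^{1/2}$$ for $X,A\in\mathbb{P}$. For $t\in(0,1]$, $L_t(\mu)$ (the induced operator mean) denotes the unique solution $X\in\mathbb{P}$ of $X=\int_{[0,1]\times\mathbb{P}}M_{s,t}(X,A)\,d\mu(s,A)$. *)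

theory Defs
  imports
    "HOL-Probability.Probability"
    "HOL-Computational_Algebra.Polynomial"
begin

section \<open>Complex Hilbert spaces\<close>

text \<open>
  The inner product is linear in its first argument.  Positive definiteness and the norm are
  inherited from \<^class>\<open>real_inner\<close>, since the real inner product is the real part of the
  complex one.  The dimension is arbitrary.
\<close>

class complex_hilbert = real_inner + banach +
  fixes scaleC :: "complex \<Rightarrow> 'a \<Rightarrow> 'a" (infixr \<open>*\<^sub>C\<close> 75)
    and cinner :: "'a \<Rightarrow> 'a \<Rightarrow> complex"
  assumes scaleC_add_right: "c *\<^sub>C (x + y) = c *\<^sub>C x + c *\<^sub>C y"
    and scaleC_add_left: "(c + d) *\<^sub>C x = c *\<^sub>C x + d *\<^sub>C x"
    and scaleC_scaleC: "c *\<^sub>C (d *\<^sub>C x) = (c * d) *\<^sub>C x"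
    and scaleC_of_real: "complex_of_real r *\<^sub>C x = r *\<^sub>R x"
    and cinner_commute: "cinner x y = cnj (cinner y x)"
    and cinner_add_left: "cinner (x + y) z = cinner x z + cinner y z"
    and cinner_scaleC_left: "cinner (c *\<^sub>C x) y = c * cinner x y"
    and inner_eq_Re_cinner: "inner x y = Re (cinner x y)"

instantiation complex :: complex_hilbert
begin

definition scaleC_complex :: "complex \<Rightarrow> complex \<Rightarrow> complex"
  where "scaleC_complex c x = c * x"

definition cinner_complex :: "complex \<Rightarrow> complex \<Rightarrow> complex"
  where "cinner_complex x y = x * cnj y"

instance
  by standard
    (auto simp: scaleC_complex_def cinner_complex_def algebra_simps scaleR_conv_of_real
      inner_complex_def)

end


section \<open>Self-adjoint and positive definite operators\<close>

text \<open>
  Bounded operators are elements of \<^typ>\<open>'a \<Rightarrow>\<^sub>L 'a\<close>, that is, real-linear ones;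
  complex linearity is imposed in \<open>self_adjoint\<close>.  The norm, the norm topology and the strong
  operator topology of this type restrict to the usual ones on complex-linear operators.
\<close>

definition self_adjoint :: "('a::complex_hilbert \<Rightarrow>\<^sub>L 'a) set"
  where "self_adjoint =
    {A. (\<forall>c x. blinfun_apply A (c *\<^sub>C x) = c *\<^sub>C blinfun_apply A x) \<and>
        (\<forall>x y. cinner (blinfun_apply A x) y = cinner x (blinfun_apply A y))}"

text \<open>For self-adjoint \<open>A\<close> the number \<open>cinner (A x) x\<close> is real.\<close>

definition pos_semidef :: "('a::complex_hilbert \<Rightarrow>\<^sub>L 'a) \<Rightarrow> bool"
  where "pos_semidef A \<longleftrightarrow>
    A \<in> self_adjoint \<and> (\<forall>x. 0 \<le> Re (cinner (blinfun_apply A x) x))"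

definition op_le :: "('a::complex_hilbert \<Rightarrow>\<^sub>L 'a) \<Rightarrow> ('a \<Rightarrow>\<^sub>L 'a) \<Rightarrow> bool"
  where "op_le A B \<longleftrightarrow> pos_semidef (B - A)"

definition pos_def :: "('a::complex_hilbert \<Rightarrow>\<^sub>L 'a) set"
  where "pos_def = (\<Union>k\<in>{1::nat..}.
    {X \<in> self_adjoint. op_le ((1 / real k) *\<^sub>R id_blinfun) X \<and>
                       op_le X (real k *\<^sub>R id_blinfun)})"


section \<open>Continuous functional calculus\<close>

text \<open>
  The spectrum of a self-adjoint operator is contained in the real line, so only real spectral
  values are collected.
\<close>

definition op_spectrum :: "('a::complex_hilbert \<Rightarrow>\<^sub>L 'a) \<Rightarrow> real set"
  where "op_spectrum A =
    {r. \<not> (\<exists>B. B o\<^sub>L (A - r *\<^sub>R id_blinfun) = id_blinfun \<and>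
                (A - r *\<^sub>R id_blinfun) o\<^sub>L B = id_blinfun)}"

definition op_poly :: "real poly \<Rightarrow> ('a::complex_hilbert \<Rightarrow>\<^sub>L 'a) \<Rightarrow> ('a \<Rightarrow>\<^sub>L 'a)"
  where "op_poly p A = (\<Sum>i\<le>degree p. coeff p i *\<^sub>R (((o\<^sub>L) A ^^ i) id_blinfun))"

text \<open>
  For self-adjoint \<open>A\<close> and \<open>f\<close> continuous on the spectrum of \<open>A\<close>, \<open>f(A)\<close> is the norm limit of
  \<open>p\<^sub>n(A)\<close> for any real polynomials \<open>p\<^sub>n\<close> converging to \<open>f\<close> uniformly on the spectrum.
\<close>

definition op_fun :: "(real \<Rightarrow> real) \<Rightarrow> ('a::complex_hilbert \<Rightarrow>\<^sub>L 'a) \<Rightarrow> ('a \<Rightarrow>\<^sub>L 'a)"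
  where "op_fun f A = (THE T. \<exists>p :: nat \<Rightarrow> real poly.
    uniform_limit (op_spectrum A) (\<lambda>n x. poly (p n) x) f sequentially \<and>
    (\<lambda>n. op_poly (p n) A) \<longlonglongrightarrow> T)"


section \<open>The operator means and the measures\<close>

definition mean_fun :: "real \<Rightarrow> real \<Rightarrow> real \<Rightarrow> real"
  where "mean_fun s t x =
    (((1 - t) * (1 - s) + t) * x + s * (1 - t)) / ((1 - t) * (1 - s) * x + t + s * (1 - t))"

definition op_mean ::
    "real \<Rightarrow> real \<Rightarrow> ('a::complex_hilbert \<Rightarrow>\<^sub>L 'a) \<Rightarrow> ('a \<Rightarrow>\<^sub>L 'a) \<Rightarrow> ('a \<Rightarrow>\<^sub>L 'a)"
  where "op_mean s t X A =
    (let X12 = op_fun (\<lambda>x. x powr (1/2)) X; Xm12 = op_fun (\<lambda>x. x powr (-1/2)) X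
     in X12 o\<^sub>L op_fun (mean_fun s t) (Xm12 o\<^sub>L A o\<^sub>L Xm12) o\<^sub>L X12)"

definition measure_supp :: "'b::topological_space measure \<Rightarrow> 'b set"
  where "measure_supp M =
    {x \<in> space M. \<forall>U. open U \<and> x \<in> U \<longrightarrow> emeasure M (U \<inter> space M) > 0}"

text \<open>
  The measures live on the subspace \<open>[0,1] \<times> pos_def\<close>: the traces on it of the Borel sets of the
  product space are its Borel sets.  The \<open>\<sigma>\<close>-algebra is generated by the product topology; for
  nonseparable spaces it may be larger than the product \<open>\<sigma>\<close>-algebra.
\<close>

definition prob_measures_01_pos_def ::
    "(real \<times> ('a::complex_hilbert \<Rightarrow>\<^sub>L 'a)) measure set"
  where "prob_measures_01_pos_def =
    {M. sets M = sets (restrict_space borel ({0..1} \<times> pos_def)) \<and> prob_space M \<and>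
        measure M (measure_supp M) = 1 \<and>
        (\<exists>r. measure_supp M \<subseteq>
          {0..1} \<times> {A. op_le (exp (- r) *\<^sub>R id_blinfun) A \<and> op_le A (exp r *\<^sub>R id_blinfun)})}"

definition has_weak_integral ::
    "('b \<Rightarrow> ('a::complex_hilbert \<Rightarrow>\<^sub>L 'a)) \<Rightarrow> ('a \<Rightarrow>\<^sub>L 'a) \<Rightarrow> 'b measure \<Rightarrow> bool"
  where "has_weak_integral g T M \<longleftrightarrow> T \<in> self_adjoint \<and>
    (\<forall>x y. integrable M (\<lambda>\<omega>. cinner (blinfun_apply (g \<omega>) x) y) \<and>
           cinner (blinfun_apply T x) y = (\<integral>\<omega>. cinner (blinfun_apply (g \<omega>) x) y \<partial>M))"

definition induced_mean ::
    "real \<Rightarrow> (real \<times> ('a::complex_hilbert \<Rightarrow>\<^sub>L 'a)) measure \<Rightarrow> ('a \<Rightarrow>\<^sub>L 'a)"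
  where "induced_mean t M =
    (THE X. X \<in> pos_def \<and> has_weak_integral (\<lambda>(s, A). op_mean s t X A) X M)"

end

theory Submission
  imports Defs "HOL-Computational_Algebra.Fundamental_Theorem_Algebra"
begin

text \<open>
  The induced means \<open>L\<^sub>t(\<mu>)\<close> decrease as \<open>t\<close> decreases to \<open>0\<close>, and they stay between two positive multiples
  of the identity.  A bounded monotone family of self-adjoint operators converges strongly
  (\<open>monotone_strong_limit\<close>), which gives the limit.

  The functional calculus can be removed from the means.  With \<open>d = t + s (1 - t)\<close>,
  \<open>M\<^sub>s\<^sub>,\<^sub>t(X, A) = (1 - t/d) X + (t/d) H\<^sub>d(X, A)\<close>, where \<open>H\<^sub>d(X, A) = ((1 - d) X\<^sup>-\<^sup>1 + d A\<^sup>-\<^sup>1)\<^sup>-\<^sup>1\<close> is the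
  weighted harmonic mean (\<open>op_mean_eq_harm_mean\<close>).  Since inversion is antitone and convex, three
  properties of the map \<open>F\<^sub>t(X) = \<integral> M\<^sub>s\<^sub>,\<^sub>t(X, A) d\<mu>(s, A)\<close> follow:

    \<^item> \<open>F\<^sub>t\<close> is monotone;
    \<^item> on bounded sets \<open>F\<^sub>t(r X) \<le> (1 + \<theta> (r - 1)) F\<^sub>t(X)\<close> for \<open>r \<ge> 1\<close> with some \<open>\<theta> < 1\<close>, that is,
      \<open>F\<^sub>t\<close> contracts the Thompson metric (\<open>op_mean_scale_le\<close>);
    \<^item> \<open>(F\<^sub>t(X) - X) / t\<close> increases with \<open>t\<close>, because \<open>(M\<^sub>s\<^sub>,\<^sub>t(X, A) - X) / t = (H\<^sub>d(X, A) - X) / d\<close> and a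
      harmonic mean lies below the arithmetic one (\<open>op_mean_parameter_mono\<close>).

  The first two give a comparison principle: \<open>Y \<le> F\<^sub>t(Y)\<close> and \<open>F\<^sub>t(X) \<le> X\<close> imply \<open>Y \<le> X\<close>
  (\<open>mean_map_comparison\<close>).  It yields uniqueness of the fixed point of \<open>F\<^sub>t\<close>, and iteration from both ends of an
  order interval yields existence.  By the third property the fixed point for \<open>t'\<close> satisfies
  \<open>F\<^sub>t(X) \<le> X\<close> whenever \<open>t \<le> t'\<close>, so the comparison principle makes \<open>L\<^sub>t(\<mu>)\<close> monotone in \<open>t\<close>.

  What remains is to give meaning to the ingredients on a Hilbert space of arbitrary dimension: the
  functional calculus is well defined because \<open>\<parallel>p(A)\<parallel>\<close> is at most the supremum of \<open>\<bar>p\<bar>\<close> on the spectrum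
  (\<open>op_poly_norm_le\<close>), and weak integrals exist by the Riesz representation theorem.
\<close>

section \<open>Self-adjoint operators and the real inner product\<close>

lemma Im_cinner: "Im (cinner x y) = inner x (\<i> *\<^sub>C y)"
proof -
  have "cinner x (\<i> *\<^sub>C y) = - \<i> * cinner x y"
    by (metis cinner_commute cinner_scaleC_left complex_cnj_i complex_cnj_mult)
  then show ?thesis
    by (simp add: inner_eq_Re_cinner)
qed

lemma inner_scaleC_left: "inner (c *\<^sub>C x) y = inner x (cnj c *\<^sub>C y)"
proof -
  have "cinner x (cnj c *\<^sub>C y) = c * cinner x y"
    by (metis cinner_commute cinner_scaleC_left complex_cnj_cnj complex_cnj_mult)
  then show ?thesis
    by (simp add: inner_eq_Re_cinner cinner_scaleC_left)
qed

text \<open>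
  Both conditions are linear in the scalars \<open>\<langle>Ax, y\<rangle>\<close>, so they survive weak limits and weak
  integrals of operators.
\<close>

lemma self_adjoint_iff_inner:
  "A \<in> self_adjoint \<longleftrightarrow>
    (\<forall>x y. inner (blinfun_apply A x) y = inner x (blinfun_apply A y)) \<and>
    (\<forall>c x y. inner (blinfun_apply A (c *\<^sub>C x)) y = inner (blinfun_apply A x) (cnj c *\<^sub>C y))"
  (is "_ \<longleftrightarrow> ?S \<and> ?L")
proof
  assume "A \<in> self_adjoint"
  then show "?S \<and> ?L"
    by (auto simp: self_adjoint_def inner_eq_Re_cinner inner_scaleC_left[unfolded inner_eq_Re_cinner])
next
  assume *: "?S \<and> ?L"
  have lin: "blinfun_apply A (c *\<^sub>C x) = c *\<^sub>C blinfun_apply A x" for c x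
    using * by (metis inner_scaleC_left vector_eq_rdot)
  have "cinner (blinfun_apply A x) y = cinner x (blinfun_apply A y)" for x y
  proof (rule complex_eqI)
    show "Re (cinner (A x) y) = Re (cinner x (A y))"
      using * by (simp flip: inner_eq_Re_cinner)
    have "inner (A x) (\<i> *\<^sub>C y) = inner x (\<i> *\<^sub>C A y)"
      using * lin by metis
    then show "Im (cinner (A x) y) = Im (cinner x (A y))"
      by (simp add: Im_cinner)
  qed
  with lin show "A \<in> self_adjoint"
    by (auto simp: self_adjoint_def)
qed

lemma self_adjoint_inner:
  "A \<in> self_adjoint \<Longrightarrow> inner (blinfun_apply A x) y = inner x (blinfun_apply A y)"
  by (simp add: self_adjoint_iff_inner)

lemma self_adjoint_scaleC:
  "A \<in> self_adjoint \<Longrightarrow> blinfun_apply A (c *\<^sub>C x) = c *\<^sub>C blinfun_apply A x"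
  by (simp add: self_adjoint_def)

text \<open>
  The imaginary part of \<open>cinner\<close> is recovered from the real one by complex linearity, so real
  symmetry suffices.
\<close>

lemma self_adjointI:
  assumes "\<And>x y. inner (blinfun_apply A x) y = inner x (blinfun_apply A y)"
    and "\<And>c x. blinfun_apply A (c *\<^sub>C x) = c *\<^sub>C blinfun_apply A x"
  shows "A \<in> self_adjoint"
  unfolding self_adjoint_iff_inner using assms by (simp add: inner_scaleC_left del: assms(1))

lemma scaleC_diff_right: "c *\<^sub>C (x - y) = c *\<^sub>C x - c *\<^sub>C (y :: 'a::complex_hilbert)"
  by (metis add_diff_cancel_right' diff_add_cancel scaleC_add_right)

lemma scaleC_scaleR: "c *\<^sub>C (r *\<^sub>R x) = r *\<^sub>R (c *\<^sub>C (x :: 'a::complex_hilbert))"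
  by (metis mult.commute scaleC_of_real scaleC_scaleC)

lemma self_adjoint_weak_limit:
  assumes "\<And>n. A n \<in> self_adjoint"
    and "\<And>x y. ((\<lambda>n. inner (blinfun_apply (A n) x) y) \<longlongrightarrow> inner (blinfun_apply T x) y) sequentially"
  shows "T \<in> self_adjoint"
  unfolding self_adjoint_iff_inner
proof (intro conjI allI)
  fix x y
  have "(\<lambda>n. inner (A n x) y) \<longlonglongrightarrow> inner x (T y)"
    using assms(2)[of y x] by (simp add: self_adjoint_inner[OF assms(1)] inner_commute[of x])
  then show "inner (T x) y = inner x (T y)"
    using LIMSEQ_unique assms(2) by blast
next
  fix c x y
  have "(\<lambda>n. inner (A n (c *\<^sub>C x)) y) \<longlonglongrightarrow> inner (T x) (cnj c *\<^sub>C y)"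
    using assms(2)[of x "cnj c *\<^sub>C y"]
    by (simp add: self_adjoint_scaleC[OF assms(1)] inner_scaleC_left)
  then show "inner (T (c *\<^sub>C x)) y = inner (T x) (cnj c *\<^sub>C y)"
    using LIMSEQ_unique assms(2) by blast
qed

lemma self_adjoint_limit:
  assumes "\<And>n. A n \<in> self_adjoint" "A \<longlonglongrightarrow> T"
  shows "T \<in> self_adjoint"
  by (rule self_adjoint_weak_limit[of A, OF assms(1)]) (intro tendsto_intros assms(2))

lemma self_adjoint_add: "A \<in> self_adjoint \<Longrightarrow> B \<in> self_adjoint \<Longrightarrow> A + B \<in> self_adjoint"
  by (rule self_adjointI)
    (simp_all add: blinfun.bilinear_simps inner_simps self_adjoint_inner self_adjoint_scaleC
      scaleC_add_right)

lemma self_adjoint_diff: "A \<in> self_adjoint \<Longrightarrow> B \<in> self_adjoint \<Longrightarrow> A - B \<in> self_adjoint"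
  by (rule self_adjointI)
    (simp_all add: blinfun.bilinear_simps inner_simps self_adjoint_inner self_adjoint_scaleC
      scaleC_diff_right)

lemma self_adjoint_scaleR: "A \<in> self_adjoint \<Longrightarrow> r *\<^sub>R A \<in> self_adjoint"
  by (rule self_adjointI)
    (simp_all add: blinfun.bilinear_simps self_adjoint_inner self_adjoint_scaleC scaleC_scaleR)

lemma self_adjoint_id: "id_blinfun \<in> self_adjoint"
  by (simp add: self_adjoint_iff_inner inner_scaleC_left)

lemma self_adjoint_zero: "0 \<in> self_adjoint"
  using self_adjoint_scaleR[OF self_adjoint_id, of 0] by simp

lemma self_adjoint_congruence:
  "R \<in> self_adjoint \<Longrightarrow> A \<in> self_adjoint \<Longrightarrow> R o\<^sub>L A o\<^sub>L R \<in> self_adjoint"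
  by (simp add: self_adjoint_def)

lemmas self_adjoint_intros =
  self_adjoint_add self_adjoint_diff self_adjoint_scaleR self_adjoint_id self_adjoint_zero

lemma op_le_iff:
  "A \<in> self_adjoint \<Longrightarrow> B \<in> self_adjoint \<Longrightarrow>
    op_le A B \<longleftrightarrow> (\<forall>x. inner (blinfun_apply A x) x \<le> inner (blinfun_apply B x) x)"
  by (simp add: op_le_def pos_semidef_def self_adjoint_diff blinfun.bilinear_simps inner_simps
      flip: inner_eq_Re_cinner)

text \<open>
  Order intervals between multiples of the identity, written with quadratic forms.  The cone
  \<open>pos_def\<close> is their union over \<open>m > 0\<close>, and all estimates for the means are uniform on one such
  interval.
\<close>

definition op_box :: "real \<Rightarrow> real \<Rightarrow> ('a::complex_hilbert \<Rightarrow>\<^sub>L 'a) set"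
  where "op_box m M = {X \<in> self_adjoint.
    \<forall>x. m * (norm x)\<^sup>2 \<le> inner (blinfun_apply X x) x \<and> inner (blinfun_apply X x) x \<le> M * (norm x)\<^sup>2}"

lemma op_box_iff_op_le:
  "X \<in> op_box m M \<longleftrightarrow>
    X \<in> self_adjoint \<and> op_le (m *\<^sub>R id_blinfun) X \<and> op_le X (M *\<^sub>R id_blinfun)"
  by (auto simp: op_box_def op_le_iff self_adjoint_intros blinfun.bilinear_simps
      power2_norm_eq_inner)

lemma op_box_self_adjoint: "X \<in> op_box m M \<Longrightarrow> X \<in> self_adjoint"
  by (simp add: op_box_def)

lemma op_box_lower: "X \<in> op_box m M \<Longrightarrow> m * (norm x)\<^sup>2 \<le> inner (blinfun_apply X x) x"
  and op_box_upper: "X \<in> op_box m M \<Longrightarrow> inner (blinfun_apply X x) x \<le> M * (norm x)\<^sup>2"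
  by (simp_all add: op_box_def)

lemma op_box_mono: "X \<in> op_box m M \<Longrightarrow> m' \<le> m \<Longrightarrow> M \<le> M' \<Longrightarrow> X \<in> op_box m' M'"
  unfolding op_box_def
  by (auto intro: order_trans[OF mult_right_mono] order_trans[OF _ mult_right_mono])

lemma pos_def_iff_op_box: "X \<in> pos_def \<longleftrightarrow> (\<exists>m>0. \<exists>M>0. X \<in> op_box m M)"
proof
  assume "X \<in> pos_def"
  then obtain k :: nat where "k \<ge> 1" "X \<in> op_box (1 / real k) (real k)"
    by (auto simp: pos_def_def op_box_iff_op_le)
  then show "\<exists>m>0. \<exists>M>0. X \<in> op_box m M"
    by (intro exI[of _ "1 / real k"] exI[of _ "real k"] conjI) auto
next
  assume "\<exists>m>0. \<exists>M>0. X \<in> op_box m M"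
  then obtain m M where mM: "m > 0" "M > 0" "X \<in> op_box m M"
    by blast
  obtain k :: nat where k: "real k \<ge> max 1 (max (1 / m) M)"
    using real_arch_simple by blast
  then have "1 / real k \<le> m" "k \<ge> 1"
    using mM(1) by (auto simp: field_simps)
  then have "X \<in> op_box (1 / real k) (real k)" "k \<ge> 1"
    using op_box_mono[OF mM(3)] k by auto
  then show "X \<in> pos_def"
    by (auto simp: pos_def_def op_box_iff_op_le)
qed

lemma op_box_pos_def: "X \<in> op_box m M \<Longrightarrow> 0 < m \<Longrightarrow> 0 < M \<Longrightarrow> X \<in> pos_def"
  using pos_def_iff_op_box by blast

lemma pos_def_self_adjoint: "X \<in> pos_def \<Longrightarrow> X \<in> self_adjoint"
  by (auto simp: pos_def_iff_op_box op_box_def)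

lemma pos_def_inner_ge_0: "X \<in> pos_def \<Longrightarrow> 0 \<le> inner (blinfun_apply X x) x"
  by (smt (verit, best) mult_nonneg_nonneg op_box_lower pos_def_iff_op_box zero_le_power2)

lemma op_le_pos_def_iff:
  "A \<in> pos_def \<Longrightarrow> B \<in> pos_def \<Longrightarrow>
    op_le A B \<longleftrightarrow> (\<forall>x. inner (blinfun_apply A x) x \<le> inner (blinfun_apply B x) x)"
  by (simp add: op_le_iff pos_def_self_adjoint)

lemma id_op_box: "m *\<^sub>R id_blinfun \<in> op_box m m"
  by (simp add: op_box_def self_adjoint_intros blinfun.bilinear_simps power2_norm_eq_inner)

lemma id_pos_def: "0 < m \<Longrightarrow> m *\<^sub>R id_blinfun \<in> pos_def"
  using id_op_box op_box_pos_def by blast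

lemma op_box_scaleR: "X \<in> op_box m M \<Longrightarrow> 0 \<le> r \<Longrightarrow> r *\<^sub>R X \<in> op_box (r * m) (r * M)"
  by (auto simp: op_box_def self_adjoint_scaleR blinfun.bilinear_simps mult.assoc
      intro: mult_left_mono)

lemma pos_def_scaleR: "X \<in> pos_def \<Longrightarrow> 0 < r \<Longrightarrow> r *\<^sub>R X \<in> pos_def"
  by (meson less_imp_le mult_pos_pos op_box_pos_def op_box_scaleR pos_def_iff_op_box)

lemma op_box_add: "X \<in> op_box m M \<Longrightarrow> Y \<in> op_box m' M' \<Longrightarrow> X + Y \<in> op_box (m + m') (M + M')"
  by (auto simp: op_box_def self_adjoint_add blinfun.bilinear_simps inner_simps distrib_right
      intro: add_mono)

lemma pos_def_add: "X \<in> pos_def \<Longrightarrow> Y \<in> pos_def \<Longrightarrow> X + Y \<in> pos_def"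
  by (meson add_pos_pos op_box_add op_box_pos_def pos_def_iff_op_box)

lemma pos_def_convex:
  assumes "X \<in> pos_def" "Y \<in> pos_def" "0 \<le> r" "r \<le> 1"
  shows "(1 - r) *\<^sub>R X + r *\<^sub>R Y \<in> pos_def"
proof (cases "r = 0 \<or> r = 1")
  case False
  with assms show ?thesis
    by (intro pos_def_add pos_def_scaleR) auto
qed (use assms in auto)

lemma op_le_refl: "A \<in> self_adjoint \<Longrightarrow> op_le A A"
  by (simp add: op_le_iff)

lemma op_le_trans [trans]: "op_le A B \<Longrightarrow> op_le B C \<Longrightarrow> op_le A C"
  unfolding op_le_def pos_semidef_def
  using self_adjoint_add[of "B - A" "C - B"]
  by (auto simp: blinfun.bilinear_simps inner_simps simp flip: inner_eq_Re_cinner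
      intro: order_trans)

lemma op_le_scaleR: "op_le A B \<Longrightarrow> 0 \<le> r \<Longrightarrow> op_le (r *\<^sub>R A) (r *\<^sub>R B)"
  unfolding op_le_def pos_semidef_def
  using self_adjoint_scaleR[of "B - A" r]
  by (simp add: blinfun.bilinear_simps flip: inner_eq_Re_cinner scaleR_diff_right)

text \<open>
  Polarisation turns a bound on the quadratic form into a bound on the norm.
\<close>

lemma self_adjoint_norm_le:
  assumes "P \<in> self_adjoint" "\<And>x. \<bar>inner (blinfun_apply P x) x\<bar> \<le> q * (norm x)\<^sup>2" "0 \<le> q"
  shows "norm P \<le> q"
proof (rule norm_blinfun_bound[OF assms(3)])
  fix x
  show "norm (P x) \<le> q * norm x"
  proof (cases "P x = 0 \<or> x = 0")
    case False
    define y where "y = (norm x / norm (P x)) *\<^sub>R P x"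
    have ny: "norm y = norm x"
      using False by (simp add: y_def)
    have "inner (P x) y = norm x * norm (P x)"
      using False by (simp add: y_def dot_square_norm power2_eq_square)
    moreover have "4 * inner (P x) y = inner (P (x + y)) (x + y) - inner (P (x - y)) (x - y)"
      using self_adjoint_inner[OF assms(1), of y x]
      by (simp add: blinfun.bilinear_simps inner_simps inner_commute)
    moreover have "\<dots> \<le> q * (norm (x + y))\<^sup>2 + q * (norm (x - y))\<^sup>2"
      using assms(2)[of "x + y"] assms(2)[of "x - y"] by linarith
    moreover have "\<dots> = q * (4 * (norm x)\<^sup>2)"
      using ny unfolding norm_eq
      by (simp add: power2_norm_eq_inner inner_simps algebra_simps)
    ultimately have "norm (P x) * norm x \<le> q * norm x * norm x"
      by (simp add: power2_eq_square algebra_simps)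
    then show ?thesis
      using False by simp
  qed (use assms(3) in auto)
qed

lemma op_box_norm_le:
  assumes "X \<in> op_box m M" "0 \<le> m" "0 \<le> M"
  shows "norm X \<le> M"
proof (rule self_adjoint_norm_le)
  show "\<bar>inner (X x) x\<bar> \<le> M * (norm x)\<^sup>2" for x
    using op_box_lower[OF assms(1), of x] op_box_upper[OF assms(1), of x] assms(2)
    by (smt (verit) mult_nonneg_nonneg zero_le_power2)
qed (use assms op_box_self_adjoint in auto)

section \<open>Inverses of positive definite operators\<close>

text \<open>
  If \<open>m \<le> T \<le> M\<close> then \<open>I - T / M\<close> has norm at most \<open>1 - m / M < 1\<close>, so that \<open>T x = y\<close>
  is solved by Banach's fixed point theorem.
\<close>

lemma coercive_invertible:
  fixes T :: "'a::complex_hilbert \<Rightarrow>\<^sub>L 'a"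
  assumes T: "T \<in> self_adjoint" and "0 < m" and coercive: "\<And>x. m * (norm x)\<^sup>2 \<le> inner (blinfun_apply T x) x"
  shows "\<exists>B\<in>self_adjoint. B o\<^sub>L T = id_blinfun \<and> T o\<^sub>L B = id_blinfun"
proof -
  \<comment> \<open>the summand \<open>m\<close> keeps \<open>M\<close> positive on the trivial space\<close>
  define M where "M = norm T + m"
  have M: "0 < M" "m \<le> M"
    using \<open>0 < m\<close> by (auto simp: M_def add_nonneg_pos)
  have upper: "inner (T x) x \<le> M * (norm x)\<^sup>2" for x
  proof -
    have "inner (T x) x \<le> norm (T x) * norm x"
      by (rule norm_cauchy_schwarz)
    also have "\<dots> \<le> norm T * norm x * norm x"
      by (intro mult_right_mono norm_blinfun) auto
    also have "\<dots> \<le> M * norm x * norm x"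
      using \<open>0 < m\<close> by (intro mult_right_mono) (auto simp: M_def)
    finally show ?thesis
      by (simp add: power2_eq_square algebra_simps)
  qed
  have bound: "norm x \<le> norm (T x) / m" for x
  proof (cases "x = 0")
    case False
    have "m * (norm x)\<^sup>2 \<le> norm (T x) * norm x"
      using coercive norm_cauchy_schwarz order_trans by blast
    then show ?thesis
      using False \<open>0 < m\<close> by (simp add: power2_eq_square field_simps)
  qed simp
  define P where "P = id_blinfun - (1 / M) *\<^sub>R T"
  have "norm P \<le> 1 - m / M"
  proof (rule self_adjoint_norm_le)
    show "P \<in> self_adjoint"
      by (simp add: P_def self_adjoint_intros T)
    show "\<bar>inner (P x) x\<bar> \<le> (1 - m / M) * (norm x)\<^sup>2" for x
      using upper[of x] coercive[of x] M
      by (simp add: P_def blinfun.bilinear_simps inner_simps power2_norm_eq_inner field_simps)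
    show "0 \<le> 1 - m / M"
      using M by simp
  qed
  then have P: "norm P < 1"
    using M \<open>0 < m\<close> by (smt (verit) divide_pos_pos)
  have "\<exists>x. T x = y" for y
  proof -
    have "\<exists>!x. P x + (1 / M) *\<^sub>R y = x"
    proof (rule banach_fix_type[OF norm_ge_zero P], intro allI)
      fix u v
      show "dist (P u + (1 / M) *\<^sub>R y) (P v + (1 / M) *\<^sub>R y) \<le> norm P * dist u v"
        using norm_blinfun[of P "u - v"] by (simp add: dist_norm blinfun.bilinear_simps)
    qed
    then obtain x where "P x + (1 / M) *\<^sub>R y = x"
      by blast
    then have "T x = y"
      using M by (simp add: P_def blinfun.bilinear_simps)
    then show ?thesis ..
  qed
  then obtain g where g: "T (g y) = y" for y
    by metis
  have inj: "u = v" if "T u = T v" for u v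
    using bound[of "u - v"] that by (simp add: blinfun.bilinear_simps)
  have "bounded_linear g"
  proof (rule bounded_linear_intro)
    show "g (x + y) = g x + g y" "g (r *\<^sub>R x) = r *\<^sub>R g x" for x y r
      by (rule inj, simp add: blinfun.bilinear_simps g)+
    show "norm (g x) \<le> norm x * (1 / m)" for x
      using bound[of "g x"] by (simp add: g)
  qed
  then have B: "blinfun_apply (Blinfun g) = g"
    by (rule bounded_linear_Blinfun_apply)
  have "Blinfun g \<in> self_adjoint"
    unfolding self_adjoint_iff_inner B
  proof (intro conjI allI)
    show "inner (g x) y = inner x (g y)" for x y
      by (metis T g self_adjoint_inner)
    have "g (c *\<^sub>C x) = c *\<^sub>C g x" for c x
      by (rule inj) (simp add: self_adjoint_scaleC[OF T] g)
    then show "inner (g (c *\<^sub>C x)) y = inner (g x) (cnj c *\<^sub>C y)" for c x y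
      by (simp add: inner_scaleC_left)
  qed
  moreover have "Blinfun g o\<^sub>L T = id_blinfun" "T o\<^sub>L Blinfun g = id_blinfun"
    by (rule blinfun_eqI, rule inj, simp add: B g, rule blinfun_eqI, simp add: B g)
  ultimately show ?thesis
    by blast
qed

definition op_inv :: "('a::real_normed_vector \<Rightarrow>\<^sub>L 'a) \<Rightarrow> ('a \<Rightarrow>\<^sub>L 'a)"
  where "op_inv T = (THE B. B o\<^sub>L T = id_blinfun \<and> T o\<^sub>L B = id_blinfun)"

lemma op_inv_eqI:
  assumes "B o\<^sub>L T = id_blinfun" "T o\<^sub>L B = id_blinfun"
  shows "op_inv T = B"
  unfolding op_inv_def
proof (rule the_equality)
  show "C = B" if "C o\<^sub>L T = id_blinfun \<and> T o\<^sub>L C = id_blinfun" for C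
    using that assms(2) by (metis blinfun_apply_blinfun_compose blinfun_apply_id_blinfun blinfun_eqI)
qed (use assms in simp)

lemma pos_def_inverse:
  assumes "X \<in> pos_def"
  shows op_inv_self_adjoint: "op_inv X \<in> self_adjoint"
    and op_inv_compose: "op_inv X o\<^sub>L X = id_blinfun" "X o\<^sub>L op_inv X = id_blinfun"
proof -
  obtain B where "B \<in> self_adjoint" "B o\<^sub>L X = id_blinfun" "X o\<^sub>L B = id_blinfun"
    using assms coercive_invertible[of X] op_box_lower
    unfolding pos_def_iff_op_box by (metis op_box_self_adjoint)
  then show "op_inv X \<in> self_adjoint" "op_inv X o\<^sub>L X = id_blinfun" "X o\<^sub>L op_inv X = id_blinfun"
    by (simp_all add: op_inv_eqI)
qed

lemma op_inv_apply:
  assumes "X \<in> pos_def"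
  shows "blinfun_apply (op_inv X) (blinfun_apply X x) = x"
    "blinfun_apply X (blinfun_apply (op_inv X) x) = x"
  using op_inv_compose[OF assms] by (metis blinfun_apply_blinfun_compose blinfun_apply_id_blinfun)+

text \<open>
  The quadratic form of \<open>X\<^sup>-\<^sup>1\<close> is the Legendre transform of the one of \<open>X\<close>:
  \<open>\<langle>X\<^sup>-\<^sup>1x, x\<rangle> = sup\<^sub>y (2 \<langle>x, y\<rangle> - \<langle>Xy, y\<rangle>)\<close>, attained at \<open>y = X\<^sup>-\<^sup>1x\<close>.  That inversion
  is antitone and convex is read off from this formula.
\<close>

lemma op_inv_legendre_ge:
  assumes "X \<in> pos_def"
  shows "2 * inner x y - inner (blinfun_apply X y) y \<le> inner (blinfun_apply (op_inv X) x) x"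
proof -
  define z where "z = op_inv X x"
  have "X z = x"
    by (simp add: z_def op_inv_apply[OF assms])
  moreover have "0 \<le> inner (X (y - z)) (y - z)"
    by (rule pos_def_inner_ge_0[OF assms])
  moreover have "inner (X y) z = inner y (X z)"
    by (simp add: self_adjoint_inner pos_def_self_adjoint assms)
  ultimately show ?thesis
    by (simp add: blinfun.bilinear_simps inner_simps inner_commute flip: z_def)
qed

lemma op_inv_legendre_eq:
  assumes "X \<in> pos_def"
  shows "inner (blinfun_apply (op_inv X) x) x =
    2 * inner x (blinfun_apply (op_inv X) x)
      - inner (blinfun_apply X (blinfun_apply (op_inv X) x)) (blinfun_apply (op_inv X) x)"
  by (simp add: op_inv_apply[OF assms] inner_commute)

lemma op_inv_antitone_form:
  assumes "X \<in> pos_def" "Y \<in> pos_def" "\<And>x. inner (blinfun_apply X x) x \<le> inner (blinfun_apply Y x) x"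
  shows "inner (blinfun_apply (op_inv Y) x) x \<le> inner (blinfun_apply (op_inv X) x) x"
  using op_inv_legendre_eq[OF assms(2), of x] op_inv_legendre_ge[OF assms(1), of x "op_inv Y x"]
    assms(3)[of "op_inv Y x"]
  by linarith

lemma op_inv_convex_form:
  assumes "X \<in> pos_def" "Y \<in> pos_def" "0 \<le> r" "r \<le> 1"
  shows "inner (blinfun_apply (op_inv ((1 - r) *\<^sub>R X + r *\<^sub>R Y)) x) x
    \<le> (1 - r) * inner (blinfun_apply (op_inv X) x) x + r * inner (blinfun_apply (op_inv Y) x) x"
proof -
  define W where "W = (1 - r) *\<^sub>R X + r *\<^sub>R Y"
  have "W \<in> pos_def"
    unfolding W_def by (intro pos_def_convex assms)
  define y where "y = op_inv W x"
  have "inner (op_inv W x) x = 2 * inner x y - inner (W y) y"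
    unfolding y_def by (rule op_inv_legendre_eq[OF \<open>W \<in> pos_def\<close>])
  also have "\<dots> = (1 - r) * (2 * inner x y - inner (X y) y) + r * (2 * inner x y - inner (Y y) y)"
    by (simp add: W_def blinfun.bilinear_simps inner_simps algebra_simps)
  also have "\<dots> \<le> (1 - r) * inner (op_inv X x) x + r * inner (op_inv Y x) x"
    using assms by (intro add_mono mult_left_mono op_inv_legendre_ge) auto
  finally show ?thesis
    unfolding W_def .
qed

lemma op_inv_scaleR:
  assumes "X \<in> pos_def" "r \<noteq> 0"
  shows "op_inv (r *\<^sub>R X) = (1 / r) *\<^sub>R op_inv X"
  by (rule op_inv_eqI; rule blinfun_eqI) (simp_all add: blinfun.bilinear_simps op_inv_apply assms)

lemma op_inv_op_box:
  assumes "X \<in> op_box m M" "0 < m" "0 < M"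
  shows "op_inv X \<in> op_box (1 / M) (1 / m)"
proof -
  have X: "X \<in> pos_def"
    using assms op_box_pos_def by blast
  have inv: "op_inv (r *\<^sub>R id_blinfun) = (1 / r) *\<^sub>R (id_blinfun :: 'a \<Rightarrow>\<^sub>L 'a)" if "0 < r" for r
    by (rule op_inv_eqI; rule blinfun_eqI) (use that in \<open>simp_all add: blinfun.bilinear_simps\<close>)
  have "1 / M * (norm x)\<^sup>2 \<le> inner (op_inv X x) x" for x
    using op_inv_antitone_form[OF X id_pos_def[OF assms(3)], of x] op_box_upper[OF assms(1)]
    by (simp add: inv assms blinfun.bilinear_simps power2_norm_eq_inner)
  moreover have "inner (op_inv X x) x \<le> 1 / m * (norm x)\<^sup>2" for x
    using op_inv_antitone_form[OF id_pos_def[OF assms(2)] X, of x] op_box_lower[OF assms(1)]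
    by (simp add: inv assms blinfun.bilinear_simps power2_norm_eq_inner)
  ultimately show ?thesis
    by (simp add: op_box_def op_inv_self_adjoint[OF X])
qed

lemma op_inv_pos_def: "X \<in> pos_def \<Longrightarrow> op_inv X \<in> pos_def"
  unfolding pos_def_iff_op_box by (metis op_inv_op_box zero_less_divide_1_iff)

lemma op_inv_op_inv: "X \<in> pos_def \<Longrightarrow> op_inv (op_inv X) = X"
  by (rule op_inv_eqI) (simp_all add: op_inv_compose)

text \<open>
  If \<open>X \<ge> m\<close> and \<open>Y\<close> is within \<open>m / 2\<close> of \<open>X\<close>, then \<open>Y \<ge> m / 2\<close>, and
  \<open>Y\<^sup>-\<^sup>1 - X\<^sup>-\<^sup>1 = Y\<^sup>-\<^sup>1 (X - Y) X\<^sup>-\<^sup>1\<close> has norm at most \<open>2 \<parallel>X - Y\<parallel> / m\<^sup>2\<close>.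
\<close>

lemma continuous_on_op_inv: "continuous_on pos_def op_inv"
proof (clarsimp simp: continuous_on_iff)
  fix X :: "'a \<Rightarrow>\<^sub>L 'a" and e :: real
  assume X: "X \<in> pos_def" and e: "0 < e"
  then obtain m M where mM: "0 < m" "0 < M" "X \<in> op_box m M"
    by (auto simp: pos_def_iff_op_box)
  have X': "norm (op_inv X) \<le> 1 / m"
    using op_box_norm_le[OF op_inv_op_box[OF mM(3,1,2)]] mM by simp
  show "\<exists>d>0. \<forall>Y\<in>pos_def. dist Y X < d \<longrightarrow> dist (op_inv Y) (op_inv X) < e"
  proof (intro exI[of _ "min (m / 2) (e * m\<^sup>2 / 2)"] conjI ballI impI)
    fix Y :: "'a \<Rightarrow>\<^sub>L 'a"
    assume Y: "Y \<in> pos_def" and *: "dist Y X < min (m / 2) (e * m\<^sup>2 / 2)"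
    obtain n N where N: "0 < n" "0 < N" "Y \<in> op_box n N"
      using Y by (auto simp: pos_def_iff_op_box)
    have "m / 2 * (norm x)\<^sup>2 \<le> inner (Y x) x" for x
    proof -
      have "inner ((X - Y) x) x \<le> norm (X - Y) * norm x * norm x"
        by (meson mult_right_mono norm_blinfun norm_cauchy_schwarz norm_ge_zero order_trans)
      also have "\<dots> \<le> m / 2 * norm x * norm x"
        using * by (intro mult_right_mono) (auto simp: dist_norm norm_minus_commute)
      finally show ?thesis
        using op_box_lower[OF mM(3), of x]
        by (simp add: blinfun.bilinear_simps inner_simps power2_eq_square)
    qed
    then have "Y \<in> op_box (m / 2) N"
      using N by (auto simp: op_box_def)
    then have Y': "norm (op_inv Y) \<le> 2 / m"
      using op_box_norm_le[OF op_inv_op_box[of Y "m / 2" N]] mM N by simp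
    have "op_inv Y - op_inv X = op_inv Y o\<^sub>L (X - Y) o\<^sub>L op_inv X"
      by (rule blinfun_eqI) (simp add: blinfun.bilinear_simps op_inv_apply X Y)
    then have "dist (op_inv Y) (op_inv X) \<le> norm (op_inv Y) * norm (X - Y) * norm (op_inv X)"
      using norm_blinfun_compose[of "op_inv Y o\<^sub>L (X - Y)" "op_inv X"]
        mult_right_mono[OF norm_blinfun_compose[of "op_inv Y" "X - Y"] norm_ge_zero[of "op_inv X"]]
      by (simp add: dist_norm)
    also have "\<dots> \<le> (2 / m) * norm (X - Y) * (1 / m)"
      using mM by (intro mult_mono X' Y') auto
    also have "\<dots> < e"
    proof -
      have "norm (X - Y) < e * m\<^sup>2 / 2"
        using * by (simp add: dist_norm norm_minus_commute)
      then show ?thesis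
        using mM by (simp add: field_simps power2_eq_square)
    qed
    finally show "dist (op_inv Y) (op_inv X) < e" .
  qed (use mM e in auto)
qed

section \<open>Polynomials in a self-adjoint operator\<close>

lemma op_poly_eq_sum:
  assumes "degree p \<le> n"
  shows "op_poly p A = (\<Sum>i\<le>n. coeff p i *\<^sub>R (((o\<^sub>L) A ^^ i) id_blinfun))"
  unfolding op_poly_def
  by (rule sum.mono_neutral_left) (use assms in \<open>auto simp: coeff_eq_0\<close>)

lemma op_poly_pCons: "op_poly (pCons a p) A = a *\<^sub>R id_blinfun + (A o\<^sub>L op_poly p A)"
proof -
  have "op_poly (pCons a p) A = (\<Sum>i\<le>Suc (degree p). coeff (pCons a p) i *\<^sub>R (((o\<^sub>L) A ^^ i) id_blinfun))"
    by (rule op_poly_eq_sum) (simp add: degree_pCons_le)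
  also have "\<dots> = a *\<^sub>R id_blinfun + (\<Sum>i\<le>degree p. coeff p i *\<^sub>R (A o\<^sub>L ((o\<^sub>L) A ^^ i) id_blinfun))"
    by (subst sum.atMost_Suc_shift) simp
  also have "(\<Sum>i\<le>degree p. coeff p i *\<^sub>R (A o\<^sub>L ((o\<^sub>L) A ^^ i) id_blinfun)) = A o\<^sub>L op_poly p A"
    by (rule blinfun_eqI)
      (simp add: op_poly_def blinfun.sum_left blinfun.sum_right blinfun.bilinear_simps)
  finally show ?thesis .
qed

lemma op_poly_0 [simp]: "op_poly 0 A = 0"
  by (simp add: op_poly_def)

lemma op_poly_const: "op_poly [:a:] A = a *\<^sub>R id_blinfun"
  by (simp add: op_poly_def)

lemma op_poly_linear: "op_poly [:a, b:] A = a *\<^sub>R id_blinfun + b *\<^sub>R A"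
  by (rule blinfun_eqI) (simp add: op_poly_pCons blinfun.bilinear_simps)

lemma op_poly_add: "op_poly (p + q) A = op_poly p A + op_poly q A"
  by (induction p q rule: poly_induct2)
    (simp_all add: op_poly_pCons scaleR_add_left
      bounded_bilinear.add_right[OF bounded_bilinear_blinfun_compose])

lemma op_poly_smult: "op_poly (smult c p) A = c *\<^sub>R op_poly p A"
  by (induction p) (simp_all add: op_poly_pCons scaleR_add_right
      bounded_bilinear.scaleR_right[OF bounded_bilinear_blinfun_compose])

lemma op_poly_diff: "op_poly (p - q) A = op_poly p A - op_poly q A"
  using op_poly_add[of p "smult (-1) q" A] unfolding op_poly_smult by simp

lemma op_poly_mult: "op_poly (p * q) A = op_poly p A o\<^sub>L op_poly q A"
proof (induction p)
  case (pCons a p)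
  have "op_poly (pCons a p * q) A = a *\<^sub>R op_poly q A + (A o\<^sub>L (op_poly p A o\<^sub>L op_poly q A))"
    by (simp add: mult_pCons_left op_poly_add op_poly_smult op_poly_pCons pCons.IH)
  also have "\<dots> = op_poly (pCons a p) A o\<^sub>L op_poly q A"
    by (rule blinfun_eqI) (simp add: op_poly_pCons blinfun.bilinear_simps)
  finally show ?case .
qed (auto intro!: blinfun_eqI)

lemma op_poly_commute: "op_poly p A o\<^sub>L op_poly q A = op_poly q A o\<^sub>L op_poly p A"
  by (metis mult.commute op_poly_mult)

lemma op_poly_self_adjoint:
  assumes A: "A \<in> self_adjoint"
  shows "op_poly p A \<in> self_adjoint"
proof (induction p)
  case 0
  then show ?case by (simp add: self_adjoint_intros)
next
  case (pCons a p)
  have com: "A o\<^sub>L op_poly p A = op_poly p A o\<^sub>L A"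
    using op_poly_commute[of "[:0, 1:]" A p] by (simp add: op_poly_linear)
  have "A o\<^sub>L op_poly p A \<in> self_adjoint"
  proof (rule self_adjointI)
    show "inner ((A o\<^sub>L op_poly p A) x) y = inner x ((A o\<^sub>L op_poly p A) y)" for x y
      by (subst (2) com) (simp add: self_adjoint_inner A pCons.IH)
  qed (simp add: self_adjoint_scaleC A pCons.IH)
  then show ?case
    by (simp add: op_poly_pCons self_adjoint_intros)
qed

definition op_invertible :: "('a::real_normed_vector \<Rightarrow>\<^sub>L 'a) \<Rightarrow> bool"
  where "op_invertible T \<longleftrightarrow> (\<exists>B. B o\<^sub>L T = id_blinfun \<and> T o\<^sub>L B = id_blinfun)"

lemma not_in_op_spectrum_iff: "r \<notin> op_spectrum A \<longleftrightarrow> op_invertible (op_poly [:- r, 1:] A)"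
  by (simp add: op_spectrum_def op_poly_linear op_invertible_def)

lemma op_invertible_apply:
  assumes "op_invertible T"
  obtains B where "\<And>x. blinfun_apply B (blinfun_apply T x) = x" "\<And>x. blinfun_apply T (blinfun_apply B x) = x"
  using assms unfolding op_invertible_def by (metis blinfun_apply_blinfun_compose blinfun_apply_id_blinfun)

lemma op_invertibleI:
  assumes "\<And>x. blinfun_apply B (blinfun_apply T x) = x" "\<And>x. blinfun_apply T (blinfun_apply B x) = x"
  shows "op_invertible T"
  unfolding op_invertible_def by (intro exI[of _ B]) (auto intro!: blinfun_eqI simp: assms)

lemma op_invertible_compose:
  assumes "op_invertible S" "op_invertible T"
  shows "op_invertible (S o\<^sub>L T)"
proof -
  obtain B where B: "\<And>x. blinfun_apply B (S x) = x" "\<And>x. S (blinfun_apply B x) = x"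
    using op_invertible_apply[OF assms(1)] by blast
  obtain C where C: "\<And>x. blinfun_apply C (T x) = x" "\<And>x. T (blinfun_apply C x) = x"
    using op_invertible_apply[OF assms(2)] by blast
  show ?thesis
    by (rule op_invertibleI[where B = "C o\<^sub>L B"]) (simp_all add: B C)
qed

lemma op_invertible_scaleR:
  assumes "op_invertible T" "c \<noteq> 0"
  shows "op_invertible (c *\<^sub>R T)"
proof -
  obtain B where B: "\<And>x. blinfun_apply B (T x) = x" "\<And>x. T (blinfun_apply B x) = x"
    using op_invertible_apply[OF assms(1)] by blast
  show ?thesis
    by (rule op_invertibleI[where B = "(1 / c) *\<^sub>R B"])
      (simp_all add: B blinfun.bilinear_simps assms(2))
qed

lemma poly_map_of_real_add:
  "poly (map_poly complex_of_real (p + q)) z = poly (map_poly complex_of_real p) z + poly (map_poly complex_of_real q) z"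
  by (induction p q rule: poly_induct2) (simp_all add: map_poly_pCons algebra_simps)

lemma poly_map_of_real_mult:
  "poly (map_poly complex_of_real (p * q)) z = poly (map_poly complex_of_real p) z * poly (map_poly complex_of_real q) z"
proof (induction p)
  case (pCons a p)
  then show ?case
    by (simp add: mult_pCons_left poly_map_of_real_add map_poly_pCons map_poly_smult algebra_simps)
qed simp

text \<open>
  Take a complex root.  If it is real, it gives the linear factor.  If it is \<open>u + \<i> v\<close> with \<open>v \<noteq> 0\<close>,
  the remainder of \<open>p\<close> modulo \<open>(x - u)\<^sup>2 + v\<^sup>2\<close> is a real polynomial of degree at most \<open>1\<close> that vanishes
  at a nonreal point, hence it is \<open>0\<close>.
\<close>

lemma real_poly_factor:
  fixes p :: "real poly"
  assumes "degree p > 0"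
  shows "(\<exists>r. [:- r, 1:] dvd p) \<or> (\<exists>u v. v \<noteq> 0 \<and> [:u\<^sup>2 + v\<^sup>2, - 2 * u, 1:] dvd p)"
proof -
  let ?c = "map_poly complex_of_real"
  have "degree (?c p) = degree p"
    by (rule degree_map_poly) simp
  then have "\<not> constant (poly (?c p))"
    using assms by (simp add: constant_degree)
  then obtain z where z: "poly (?c p) z = 0"
    using fundamental_theorem_of_algebra by blast
  show ?thesis
  proof (cases "Im z = 0")
    case True
    then have "z = of_real (Re z)"
      by (simp add: complex_eq_iff)
    moreover have "poly (?c q) (of_real x) = of_real (poly q x)" for q x
      by (induction q) (simp_all add: map_poly_pCons)
    ultimately have "poly p (Re z) = 0"
      using z by (metis of_real_eq_0_iff)
    then show ?thesis
      using poly_eq_0_iff_dvd by blast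
  next
    case False
    define q where "q = [:(Re z)\<^sup>2 + (Im z)\<^sup>2, - 2 * Re z, 1:]"
    have qz: "poly (?c q) z = 0"
      by (simp add: q_def map_poly_pCons complex_eq_iff power2_eq_square algebra_simps)
    have "poly (?c (p mod q)) z = 0"
      using z poly_map_of_real_add[of "p div q * q" "p mod q" z]
      by (simp add: poly_map_of_real_mult qz)
    moreover obtain a b where ab: "p mod q = [:a, b:]"
    proof -
      have "q \<noteq> 0" "degree q = 2"
        by (auto simp: q_def)
      then have "degree (p mod q) < 2"
        by (metis degree_0 degree_mod_less pos2)
      then have "p mod q = [:coeff (p mod q) 0, coeff (p mod q) 1:]"
        by (intro poly_eqI) (auto simp: coeff_pCons coeff_eq_0 split: nat.splits)
      then show ?thesis
        using that by blast
    qed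
    ultimately have "b = 0" "a = 0"
      using False by (auto simp: map_poly_pCons complex_eq_iff)
    then have "q dvd p"
      using ab by (simp add: mod_eq_0_iff_dvd)
    then show ?thesis
      using False q_def by blast
  qed
qed

text \<open>
  One half of the spectral mapping theorem.  Split \<open>p\<close> into real factors: a linear one is invertible
  at \<open>A\<close> because its root is not in the spectrum, and a quadratic one because \<open>(A - u)\<^sup>2 + v\<^sup>2 \<ge> v\<^sup>2\<close>.
\<close>

lemma op_poly_invertible:
  assumes A: "A \<in> self_adjoint" and "p \<noteq> 0" "\<And>r. r \<in> op_spectrum A \<Longrightarrow> poly p r \<noteq> 0"
  shows "op_invertible (op_poly p A)"
  using assms(2,3)
proof (induction "degree p" arbitrary: p rule: less_induct)
  case less
  have step: ?case if "op_invertible (op_poly f A)" "p = f * q" "degree f > 0" for f q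
  proof -
    have "q \<noteq> 0" "f \<noteq> 0"
      using less.prems that by auto
    then have "degree q < degree p"
      using that by (simp add: degree_mult_eq)
    then have "op_invertible (op_poly q A)"
      using less.hyps[of q] \<open>q \<noteq> 0\<close> less.prems(2) that(2) by auto
    then show ?thesis
      using that by (simp add: op_poly_mult op_invertible_compose)
  qed
  show ?case
  proof (cases "degree p = 0")
    case True
    then obtain c where "p = [:c:]"
      by (rule degree_eq_zeroE)
    moreover have "op_invertible (id_blinfun :: 'a \<Rightarrow>\<^sub>L 'a)"
      by (rule op_invertibleI[where B = id_blinfun]) simp_all
    ultimately show ?thesis
      using less.prems(1) by (simp add: op_poly_const op_invertible_scaleR)
  next
    case False
    then consider r where "[:- r, 1:] dvd p" |
      u v where "v \<noteq> 0" "[:u\<^sup>2 + v\<^sup>2, - 2 * u, 1:] dvd p"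
      using real_poly_factor by blast
    then show ?thesis
    proof cases
      case 1
      then obtain q where q: "p = [:- r, 1:] * q" ..
      then have "r \<notin> op_spectrum A"
        using less.prems(2) by auto
      then have "op_invertible (op_poly [:- r, 1:] A)"
        by (simp add: not_in_op_spectrum_iff)
      then show ?thesis
        using q by (rule step) simp
    next
      case 2
      then obtain q where q: "p = [:u\<^sup>2 + v\<^sup>2, - 2 * u, 1:] * q"
        by blast
      have "v\<^sup>2 * (norm x)\<^sup>2 \<le> inner (op_poly [:u\<^sup>2 + v\<^sup>2, - 2 * u, 1:] A x) x" for x
      proof -
        have "inner (op_poly [:u\<^sup>2 + v\<^sup>2, - 2 * u, 1:] A x) x
            = inner (A x - u *\<^sub>R x) (A x - u *\<^sub>R x) + v\<^sup>2 * (norm x)\<^sup>2"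
          using self_adjoint_inner[OF A, of "A x" x]
          unfolding power2_norm_eq_inner
          by (simp add: op_poly_pCons blinfun.bilinear_simps inner_simps power2_eq_square[of u]
              algebra_simps inner_commute)
        then show ?thesis
          by simp
      qed
      then have "op_invertible (op_poly [:u\<^sup>2 + v\<^sup>2, - 2 * u, 1:] A)"
        using coercive_invertible[OF op_poly_self_adjoint[OF A], of "v\<^sup>2"] 2(1)
        by (auto simp: op_invertible_def)
      then show ?thesis
        using q by (rule step) simp
    qed
  qed
qed

text \<open>
  From \<open>\<parallel>(c\<^sup>2 - P\<^sup>2)x\<parallel>\<^sup>2 \<le> c\<^sup>2 (c\<^sup>2\<parallel>x\<parallel>\<^sup>2 - \<parallel>Px\<parallel>\<^sup>2)\<close>, a lower bound for \<open>c\<^sup>2 - P\<^sup>2 = (c - P)(c + P)\<close>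
  would give \<open>\<parallel>P\<parallel> < c\<close>.  Hence \<open>c\<close> or \<open>- c\<close> is a spectral value of \<open>P\<close>.
\<close>

lemma norm_not_both_invertible:
  fixes P :: "'a::complex_hilbert \<Rightarrow>\<^sub>L 'a"
  assumes P: "P \<in> self_adjoint" and c: "c = norm P" "0 < c"
    and inv: "op_invertible (c *\<^sub>R id_blinfun - P)" "op_invertible (c *\<^sub>R id_blinfun + P)"
  shows False
proof -
  define Q where "Q = (c *\<^sub>R id_blinfun - P) o\<^sub>L (c *\<^sub>R id_blinfun + P)"
  obtain B where B: "\<And>x. blinfun_apply B (Q x) = x"
    using op_invertible_apply[OF op_invertible_compose[OF inv, folded Q_def]] by metis
  \<comment> \<open>the summand \<open>1\<close> avoids dividing by \<open>\<parallel>B\<parallel> = 0\<close>\<close>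
  define d where "d = 1 / (norm B + 1)"
  have d: "0 < d"
    by (simp add: d_def add_nonneg_pos)
  have lower: "d * norm x \<le> norm (Q x)" for x
  proof -
    have "norm x \<le> norm B * norm (Q x)"
      by (metis B norm_blinfun)
    also have "\<dots> \<le> (norm B + 1) * norm (Q x)"
      by (intro mult_right_mono) auto
    finally show ?thesis
      using add_nonneg_pos[OF norm_ge_zero[of B] zero_less_one]
      by (simp add: d_def field_simps)
  qed
  have Px: "(norm (P x))\<^sup>2 \<le> (c\<^sup>2 - d\<^sup>2 / c\<^sup>2) * (norm x)\<^sup>2" for x
  proof -
    have "(norm (Q x))\<^sup>2 = c ^ 4 * (norm x)\<^sup>2 - 2 * c\<^sup>2 * (norm (P x))\<^sup>2 + (norm (P (P x)))\<^sup>2"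
    proof -
      have "Q x = c\<^sup>2 *\<^sub>R x - P (P x)"
        by (simp add: Q_def blinfun.bilinear_simps power2_eq_square algebra_simps)
      moreover have "inner x (P (P x)) = inner (P x) (P x)" "inner (P (P x)) x = inner (P x) (P x)"
        by (simp_all add: self_adjoint_inner[OF P])
      moreover have "c ^ 4 = c\<^sup>2 * c\<^sup>2"
        by simp
      ultimately show ?thesis
        unfolding power2_norm_eq_inner by (simp only: inner_simps) (simp add: algebra_simps)
    qed
    moreover have "(norm (P (P x)))\<^sup>2 \<le> (c * norm (P x))\<^sup>2"
      using norm_blinfun[of P "P x"] by (intro power_mono) (auto simp: c)
    moreover have "(d * norm x)\<^sup>2 \<le> (norm (Q x))\<^sup>2"
      using lower d by (intro power_mono) auto
    ultimately have "c\<^sup>2 * (norm (P x))\<^sup>2 \<le> c ^ 4 * (norm x)\<^sup>2 - d\<^sup>2 * (norm x)\<^sup>2"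
      by (simp add: power_mult_distrib)
    then show ?thesis
      using \<open>0 < c\<close> by (simp add: field_simps power2_eq_square power4_eq_xxxx)
  qed
  define e where "e = sqrt (max 0 (c\<^sup>2 - d\<^sup>2 / c\<^sup>2))"
  have "norm P \<le> e"
  proof (rule norm_blinfun_bound)
    show "norm (P x) \<le> e * norm x" for x
    proof (rule power2_le_imp_le)
      have "(norm (P x))\<^sup>2 \<le> max 0 (c\<^sup>2 - d\<^sup>2 / c\<^sup>2) * (norm x)\<^sup>2"
        using Px[of x] by (rule order_trans) (intro mult_right_mono, auto)
      then show "(norm (P x))\<^sup>2 \<le> (e * norm x)\<^sup>2"
        by (simp add: e_def power_mult_distrib)
    qed (simp add: e_def)
  qed (simp add: e_def)
  also have "e < sqrt (c\<^sup>2)"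
    unfolding e_def using \<open>0 < c\<close> d by (intro real_sqrt_less_mono) auto
  finally show False
    using c by simp
qed

text \<open>
  If \<open>c = \<parallel>p(A)\<parallel>\<close> exceeded the bound of \<open>\<bar>p\<bar>\<close> on the spectrum, neither \<open>c - p\<close> nor \<open>c + p\<close> would
  vanish there, so both \<open>c - p(A)\<close> and \<open>c + p(A)\<close> would be invertible.  This is what makes
  \<open>op_fun\<close> independent of the approximating polynomials.
\<close>

lemma op_poly_norm_le:
  fixes A :: "'a::complex_hilbert \<Rightarrow>\<^sub>L 'a"
  assumes A: "A \<in> self_adjoint" and e: "0 \<le> e" "\<And>r. r \<in> op_spectrum A \<Longrightarrow> \<bar>poly p r\<bar> \<le> e"
  shows "norm (op_poly p A) \<le> e"
proof (rule ccontr)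
  define c where "c = norm (op_poly p A)"
  assume "\<not> norm (op_poly p A) \<le> e"
  then have c: "e < c" "0 < c"
    using e by (auto simp: c_def)
  have inv: "op_invertible (op_poly q A)"
    if "q = [:c:] - p \<or> q = [:c:] + p" for q
  proof (cases "q = 0")
    case True
    \<comment> \<open>then the spectrum is empty, which happens only on the trivial space\<close>
    have "op_spectrum A = {}"
    proof (rule ccontr)
      assume "op_spectrum A \<noteq> {}"
      then obtain r where "r \<in> op_spectrum A"
        by blast
      then have "\<bar>poly p r\<bar> \<le> e" "poly q r = 0"
        using e True by auto
      then show False
        using that c by auto
    qed
    then have all: "op_invertible (op_poly f A)" if "f \<noteq> 0" for f
      using op_poly_invertible[OF A that] by blast
    have "A = 0"
    proof (rule ccontr)
      assume "A \<noteq> 0"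
      then show False
        using norm_not_both_invertible[OF A refl] all[of "[:norm A, -1:]"] all[of "[:norm A, 1:]"]
        by (simp add: op_poly_linear)
    qed
    then have "op_invertible (0 :: 'a \<Rightarrow>\<^sub>L 'a)"
      using all[of "[:0, 1:]"] by (simp add: op_poly_linear)
    then have "x = 0" for x :: 'a
      by (metis blinfun.zero_left blinfun.zero_right op_invertible_apply)
    then show ?thesis
      by (intro op_invertibleI[where B = 0]) metis+
  next
    case False
    show ?thesis
    proof (rule op_poly_invertible[OF A False])
      show "poly q r \<noteq> 0" if "r \<in> op_spectrum A" for r
        using e(2)[OF that] c \<open>q = _ \<or> q = _\<close> by auto
    qed
  qed
  show False
    using norm_not_both_invertible[OF op_poly_self_adjoint[OF A] c_def c(2)]
      inv[of "[:c:] - p"] inv[of "[:c:] + p"]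
    by (simp add: op_poly_diff op_poly_add op_poly_const)
qed

section \<open>Continuous functional calculus\<close>

lemma op_spectrum_subset:
  assumes X: "X \<in> op_box m M"
  shows "op_spectrum X \<subseteq> {m..M}"
proof
  fix r assume r: "r \<in> op_spectrum X"
  have sa: "X \<in> self_adjoint"
    using X op_box_self_adjoint by blast
  show "r \<in> {m..M}"
  proof (rule ccontr)
    assume "r \<notin> {m..M}"
    then consider "r < m" | "M < r"
      by force
    then have "op_invertible (X - r *\<^sub>R id_blinfun)"
    proof cases
      case 1
      have "(m - r) * (norm x)\<^sup>2 \<le> inner ((X - r *\<^sub>R id_blinfun) x) x" for x
        using op_box_lower[OF X, of x]
        by (simp add: blinfun.bilinear_simps inner_simps power2_norm_eq_inner algebra_simps)
      then show ?thesis
        using coercive_invertible[of "X - r *\<^sub>R id_blinfun" "m - r"] 1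
        by (auto simp: op_invertible_def self_adjoint_intros sa)
    next
      case 2
      have "(r - M) * (norm x)\<^sup>2 \<le> inner ((r *\<^sub>R id_blinfun - X) x) x" for x
        using op_box_upper[OF X, of x]
        by (simp add: blinfun.bilinear_simps inner_simps power2_norm_eq_inner algebra_simps)
      then have "op_invertible (r *\<^sub>R id_blinfun - X)"
        using coercive_invertible[of "r *\<^sub>R id_blinfun - X" "r - M"] 2
        by (auto simp: op_invertible_def self_adjoint_intros sa)
      then show ?thesis
        using op_invertible_scaleR[of "r *\<^sub>R id_blinfun - X" "-1"] by simp
    qed
    then show False
      using r by (auto simp: op_spectrum_def op_invertible_def)
  qed
qed

lemma op_fun_eqI:
  assumes A: "A \<in> self_adjoint"
    and p: "uniform_limit (op_spectrum A) (\<lambda>n x. poly (p n) x) f sequentially"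
    and T: "(\<lambda>n. op_poly (p n) A) \<longlonglongrightarrow> T"
  shows "op_fun f A = T"
  unfolding op_fun_def
proof (rule the_equality)
  fix U assume "\<exists>q :: nat \<Rightarrow> real poly. uniform_limit (op_spectrum A) (\<lambda>n x. poly (q n) x) f sequentially \<and>
    (\<lambda>n. op_poly (q n) A) \<longlonglongrightarrow> U"
  then obtain q :: "nat \<Rightarrow> real poly" where
    q: "uniform_limit (op_spectrum A) (\<lambda>n x. poly (q n) x) f sequentially"
    and U: "(\<lambda>n. op_poly (q n) A) \<longlonglongrightarrow> U"
    by blast
  have "(\<lambda>n. op_poly (q n - p n) A) \<longlonglongrightarrow> 0"
  proof (rule tendstoI)
    fix e :: real assume e: "0 < e"
    have "uniform_limit (op_spectrum A) (\<lambda>n x. poly (q n) x - poly (p n) x) (\<lambda>x. f x - f x) sequentially"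
      by (intro uniform_limit_intros p q)
    then have "\<forall>\<^sub>F n in sequentially. \<forall>x\<in>op_spectrum A. \<bar>poly (q n - p n) x\<bar> < e / 2"
      using e uniform_limitD[where e = "e / 2"] by (fastforce simp: dist_norm)
    then show "\<forall>\<^sub>F n in sequentially. dist (op_poly (q n - p n) A) 0 < e"
    proof eventually_elim
      case (elim n)
      then have "norm (op_poly (q n - p n) A) \<le> e / 2"
        using e by (intro op_poly_norm_le[OF A]) (auto intro: less_imp_le)
      then show ?case
        using e by simp
    qed
  qed
  moreover have "(\<lambda>n. op_poly (q n - p n) A) \<longlonglongrightarrow> U - T"
    unfolding op_poly_diff by (intro tendsto_intros T U)
  ultimately show "U = T"
    using LIMSEQ_unique by fastforce
qed (use p T in blast)

lemma Weierstrass_real_poly: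
  assumes "continuous_on {m..M} (f :: real \<Rightarrow> real)"
  obtains p :: "nat \<Rightarrow> real poly" where "uniform_limit {m..M} (\<lambda>n x. poly (p n) x) f sequentially"
proof -
  have "\<exists>p. \<forall>x\<in>{m..M}. \<bar>f x - poly p x\<bar> < inverse (Suc n)" for n
  proof -
    obtain g where g: "real_polynomial_function g" "\<And>x. x \<in> {m..M} \<Longrightarrow> \<bar>f x - g x\<bar> < inverse (Suc n)"
      using Stone_Weierstrass_real_polynomial_function[of "{m..M}" f "inverse (Suc n)"] assms by auto
    then obtain a k where "g = (\<lambda>x. \<Sum>i\<le>k. a i * x ^ i)"
      by (auto simp: real_polynomial_function_iff_sum)
    then have "g = poly (\<Sum>i\<le>k. monom (a i) i)"
      by (auto simp: poly_sum poly_monom)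
    then show ?thesis
      using g by blast
  qed
  then obtain p where p: "\<And>n x. x \<in> {m..M} \<Longrightarrow> \<bar>f x - poly (p n) x\<bar> < inverse (Suc n)"
    by metis
  have "uniform_limit {m..M} (\<lambda>n x. poly (p n) x) f sequentially"
  proof (rule uniform_limitI)
    fix e :: real assume "0 < e"
    then have "\<forall>\<^sub>F n in sequentially. inverse (real (Suc n)) < e"
      using LIMSEQ_inverse_real_of_nat order_tendstoD(2) by blast
    then show "\<forall>\<^sub>F n in sequentially. \<forall>x\<in>{m..M}. dist (poly (p n) x) (f x) < e"
    proof eventually_elim
      case (elim n)
      then show ?case
        by (auto simp: dist_real_def abs_minus_commute[of _ "f _"] intro!: less_trans[OF p])
    qed
  qed
  then show ?thesis
    by (rule that)
qed

text \<open>
  By the Weierstrass theorem the operator that \<open>op_fun\<close> describes exists for every function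
  continuous on an interval that contains the spectrum; the same polynomials serve on the whole
  interval, where products are easier to control.
\<close>

lemma op_fun_approx:
  fixes X :: "'a::complex_hilbert \<Rightarrow>\<^sub>L 'a"
  assumes X: "X \<in> op_box m M" and f: "continuous_on {m..M} f"
  obtains p :: "nat \<Rightarrow> real poly" where "uniform_limit {m..M} (\<lambda>n x. poly (p n) x) f sequentially"
    "(\<lambda>n. op_poly (p n) X) \<longlonglongrightarrow> op_fun f X"
proof -
  obtain p where p: "uniform_limit {m..M} (\<lambda>n x. poly (p n) x) f sequentially"
    using Weierstrass_real_poly[OF f] by blast
  have sa: "X \<in> self_adjoint"
    using X op_box_self_adjoint by blast
  have "Cauchy (\<lambda>n. op_poly (p n) X)"
  proof (rule metric_CauchyI)
    fix e :: real assume e: "0 < e"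
    obtain N where N: "\<And>n x. n \<ge> N \<Longrightarrow> x \<in> {m..M} \<Longrightarrow> dist (poly (p n) x) (f x) < e / 4"
      using p e unfolding uniform_limit_sequentially_iff by (meson divide_pos_pos zero_less_numeral)
    have "dist (op_poly (p i) X) (op_poly (p j) X) < e" if "i \<ge> N" "j \<ge> N" for i j
    proof -
      have "norm (op_poly (p i - p j) X) \<le> e / 2"
      proof (rule op_poly_norm_le[OF sa])
        fix r assume "r \<in> op_spectrum X"
        then have "r \<in> {m..M}"
          using op_spectrum_subset[OF X] by blast
        then show "\<bar>poly (p i - p j) r\<bar> \<le> e / 2"
          using N[OF that(1), of r] N[OF that(2), of r] unfolding dist_real_def poly_diff
          by linarith
      qed (use e in simp)
      then show ?thesis
        using e by (simp add: dist_norm op_poly_diff)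
    qed
    then show "\<exists>N. \<forall>i\<ge>N. \<forall>j\<ge>N. dist (op_poly (p i) X) (op_poly (p j) X) < e"
      by blast
  qed
  then obtain T where T: "(\<lambda>n. op_poly (p n) X) \<longlonglongrightarrow> T"
    using Cauchy_convergent convergent_def by blast
  have "op_fun f X = T"
    using op_fun_eqI[OF sa uniform_limit_on_subset[OF p op_spectrum_subset[OF X]] T] .
  then show ?thesis
    using that p T by blast
qed

lemma op_fun_self_adjoint:
  assumes "X \<in> op_box m M" "continuous_on {m..M} f"
  shows "op_fun f X \<in> self_adjoint"
proof -
  obtain p where "(\<lambda>n. op_poly (p n) X) \<longlonglongrightarrow> op_fun f X"
    using op_fun_approx[OF assms] by blast
  then show ?thesis
    by (rule self_adjoint_limit[rotated])
      (use assms(1) op_box_self_adjoint op_poly_self_adjoint in blast)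
qed

lemma op_fun_mult:
  assumes X: "X \<in> op_box m M" and f: "continuous_on {m..M} f" and g: "continuous_on {m..M} g"
  shows "op_fun f X o\<^sub>L op_fun g X = op_fun (\<lambda>x. f x * g x) X"
proof -
  obtain p where p: "uniform_limit {m..M} (\<lambda>n x. poly (p n) x) f sequentially"
    "(\<lambda>n. op_poly (p n) X) \<longlonglongrightarrow> op_fun f X"
    using op_fun_approx[OF X f] by blast
  obtain q where q: "uniform_limit {m..M} (\<lambda>n x. poly (q n) x) g sequentially"
    "(\<lambda>n. op_poly (q n) X) \<longlonglongrightarrow> op_fun g X"
    using op_fun_approx[OF X g] by blast
  have bdd: "bounded (f ` {m..M})" "bounded (g ` {m..M})"
    using f g by (auto intro!: compact_imp_bounded compact_continuous_image)
  have "uniform_limit {m..M} (\<lambda>n x. poly (p n) x * poly (q n) x) (\<lambda>x. f x * g x) sequentially"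
    by (intro uniform_lim_mult p q bdd)
  then have "uniform_limit {m..M} (\<lambda>n x. poly (p n * q n) x) (\<lambda>x. f x * g x) sequentially"
    by simp
  then have "uniform_limit (op_spectrum X) (\<lambda>n x. poly (p n * q n) x) (\<lambda>x. f x * g x) sequentially"
    by (rule uniform_limit_on_subset[OF _ op_spectrum_subset[OF X]])
  moreover have "(\<lambda>n. op_poly (p n * q n) X) \<longlonglongrightarrow> (op_fun f X o\<^sub>L op_fun g X)"
    unfolding op_poly_mult
    by (intro bounded_bilinear.tendsto[OF bounded_bilinear_blinfun_compose] p q)
  ultimately show ?thesis
    using op_fun_eqI[OF op_box_self_adjoint[OF X]] by metis
qed

lemma op_fun_eq_op_poly:
  assumes X: "X \<in> op_box m M" and "\<And>x. x \<in> {m..M} \<Longrightarrow> f x = poly p x"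
  shows "op_fun f X = op_poly p X"
proof (rule op_fun_eqI[OF op_box_self_adjoint[OF X]])
  show "uniform_limit (op_spectrum X) (\<lambda>n. poly p) f sequentially"
    using assms op_spectrum_subset[OF X] by (intro uniform_limitI) auto
qed simp

lemma op_sqrt:
  assumes X: "X \<in> pos_def"
  defines "S \<equiv> op_fun (\<lambda>x. x powr (1/2)) X" and "R \<equiv> op_fun (\<lambda>x. x powr (-1/2)) X"
  shows "S o\<^sub>L S = X" "R o\<^sub>L S = id_blinfun" "S o\<^sub>L R = id_blinfun" "R \<in> self_adjoint"
proof -
  obtain m M where mM: "0 < m" "X \<in> op_box m M"
    using X by (auto simp: pos_def_iff_op_box)
  have cont: "continuous_on {m..M} (\<lambda>x. x powr (1/2))" "continuous_on {m..M} (\<lambda>x. x powr (-1/2))"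
    using mM by (auto intro!: continuous_intros)
  show "S o\<^sub>L S = X"
    unfolding S_def op_fun_mult[OF mM(2) cont(1) cont(1)]
    using op_fun_eq_op_poly[OF mM(2), of "\<lambda>x. x powr (1/2) * x powr (1/2)" "[:0, 1:]"] mM(1)
    by (simp add: op_poly_linear flip: powr_add)
  show "R o\<^sub>L S = id_blinfun"
    unfolding S_def R_def op_fun_mult[OF mM(2) cont(2) cont(1)]
    using op_fun_eq_op_poly[OF mM(2), of "\<lambda>x. x powr (-1/2) * x powr (1/2)" "[:1:]"] mM(1)
    by (simp add: op_poly_const flip: powr_add)
  show "S o\<^sub>L R = id_blinfun"
    unfolding S_def R_def op_fun_mult[OF mM(2) cont(1) cont(2)]
    using op_fun_eq_op_poly[OF mM(2), of "\<lambda>x. x powr (1/2) * x powr (-1/2)" "[:1:]"] mM(1)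
    by (simp add: op_poly_const flip: powr_add)
  show "R \<in> self_adjoint"
    unfolding R_def by (rule op_fun_self_adjoint[OF mM(2) cont(2)])
qed

section \<open>The means as mixtures of a weighted harmonic mean\<close>

definition harm_mean ::
    "real \<Rightarrow> ('a::complex_hilbert \<Rightarrow>\<^sub>L 'a) \<Rightarrow> ('a \<Rightarrow>\<^sub>L 'a) \<Rightarrow> ('a \<Rightarrow>\<^sub>L 'a)"
  where "harm_mean d X A = op_inv ((1 - d) *\<^sub>R op_inv X + d *\<^sub>R op_inv A)"

abbreviation harm_weight :: "real \<Rightarrow> real \<Rightarrow> real"
  where "harm_weight s t \<equiv> t + s * (1 - t)"

lemma harm_weight_bounds:
  assumes "0 \<le> s" "s \<le> 1" "0 < t" "t \<le> 1"
  shows "t \<le> harm_weight s t" "harm_weight s t \<le> 1" "0 < harm_weight s t"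
proof -
  have "0 \<le> s * (1 - t)" "s * (1 - t) \<le> 1 - t"
    using assms by (auto intro: mult_right_mono[of s 1, simplified])
  note * = this
  show "t \<le> harm_weight s t"
    using * by linarith
  show "harm_weight s t \<le> 1"
    using * by linarith
  show "0 < harm_weight s t"
    using * assms(3) by linarith
qed

text \<open>
  The bounds of \<open>A\<close> and of \<open>X\<^sup>-\<^sup>1\<close> multiply, because \<open>\<parallel>Rx\<parallel>\<^sup>2 = \<langle>X\<^sup>-\<^sup>1x, x\<rangle>\<close>.  The lemma is applied with
  \<open>R = X\<^sup>-\<^sup>1\<^sup>/\<^sup>2\<close>.
\<close>

lemma pos_def_sqrt_congruence:
  fixes X A :: "'a::complex_hilbert \<Rightarrow>\<^sub>L 'a"
  assumes R: "R \<in> self_adjoint" "R o\<^sub>L R = op_inv X" and X: "X \<in> pos_def" and A: "A \<in> pos_def"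
  shows "R o\<^sub>L A o\<^sub>L R \<in> pos_def"
proof -
  obtain m M where A': "0 < m" "0 < M" "A \<in> op_box m M"
    using A by (auto simp: pos_def_iff_op_box)
  obtain n N where X': "0 < n" "0 < N" "op_inv X \<in> op_box n N"
    using op_inv_pos_def[OF X] by (auto simp: pos_def_iff_op_box)
  have Rx: "(norm (R x))\<^sup>2 = inner (op_inv X x) x" for x
    using self_adjoint_inner[OF R(1), of "R x" x]
    by (simp add: power2_norm_eq_inner flip: R(2))
  have form: "inner ((R o\<^sub>L A o\<^sub>L R) x) x = inner (A (R x)) (R x)" for x
    by (simp add: self_adjoint_inner[OF R(1)])
  have "m * n * (norm x)\<^sup>2 \<le> inner (A (R x)) (R x)" for x
  proof -
    have "m * (n * (norm x)\<^sup>2) \<le> m * (norm (R x))\<^sup>2"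
      unfolding Rx using A' op_box_lower[OF X'(3)] by (intro mult_left_mono) auto
    then show ?thesis
      using op_box_lower[OF A'(3), of "R x"] by (simp add: mult.assoc)
  qed
  moreover have "inner (A (R x)) (R x) \<le> M * N * (norm x)\<^sup>2" for x
  proof -
    have "M * (norm (R x))\<^sup>2 \<le> M * (N * (norm x)\<^sup>2)"
      unfolding Rx using A' op_box_upper[OF X'(3)] by (intro mult_left_mono) auto
    then show ?thesis
      using op_box_upper[OF A'(3), of "R x"] by (simp add: mult.assoc)
  qed
  ultimately have "R o\<^sub>L A o\<^sub>L R \<in> op_box (m * n) (M * N)"
    using self_adjoint_congruence[OF R(1) pos_def_self_adjoint[OF A]] form by (simp add: op_box_def)
  then show ?thesis
    by (rule op_box_pos_def) (use A' X' in auto)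
qed

text \<open>
  With \<open>d = t + s (1 - t)\<close> the scalar function is \<open>(1 - t/d) + (t/d) x / ((1 - d) x + d)\<close>,
  and \<open>x / ((1 - d) x + d)\<close> represents the weighted harmonic mean.
\<close>

lemma op_mean_eq_harm_mean:
  fixes X A :: "'a::complex_hilbert \<Rightarrow>\<^sub>L 'a"
  assumes st: "0 \<le> s" "s \<le> 1" "0 < t" "t \<le> 1" and X: "X \<in> pos_def" and A: "A \<in> pos_def"
  defines "d \<equiv> harm_weight s t"
  shows "op_mean s t X A = (1 - t / d) *\<^sub>R X + (t / d) *\<^sub>R harm_mean d X A"
proof -
  have d: "0 < d" "d \<le> 1" "t \<le> d"
    unfolding d_def using harm_weight_bounds[OF st] by auto
  define S where "S = op_fun (\<lambda>x. x powr (1/2)) X"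
  define R where "R = op_fun (\<lambda>x. x powr (-1/2)) X"
  note S = op_sqrt[OF X, folded S_def R_def]
  have RS: "R (S x) = x" "S (R x) = x" "S (S x) = X x" for x
    using S by (metis blinfun_apply_blinfun_compose blinfun_apply_id_blinfun)+
  have RR: "R (R x) = op_inv X x" for x
    by (metis RS op_inv_apply(1)[OF X])
  then have RR': "R o\<^sub>L R = op_inv X"
    by (auto intro: blinfun_eqI)
  have RX: "R (X x) = S x" for x
    by (metis RS)
  define B where "B = R o\<^sub>L A o\<^sub>L R"
  have B: "B \<in> pos_def"
    unfolding B_def by (rule pos_def_sqrt_congruence[OF S(4) RR' X A])
  then obtain m M where mM: "0 < m" "B \<in> op_box m M"
    by (auto simp: pos_def_iff_op_box)
  have pos: "0 < (1 - d) * x + d" if "m \<le> x" for x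
    using d mM that by (intro add_nonneg_pos mult_nonneg_nonneg) auto
  have mean: "mean_fun s t = (\<lambda>x. ((1 - d + t) * x + (d - t)) / ((1 - d) * x + d))"
    by (auto simp: mean_fun_def d_def algebra_simps)
  have cont: "continuous_on {m..M} (mean_fun s t)"
    unfolding mean using pos by (auto intro!: continuous_intros simp: less_imp_neq[symmetric])
  define F where "F = op_fun (mean_fun s t) B"
  define D where "D = op_poly [:d, 1 - d:] B"
  have D_eq: "D = d *\<^sub>R id_blinfun + (1 - d) *\<^sub>R B"
    by (simp add: D_def op_poly_linear)
  have "D = (1 - (1 - d)) *\<^sub>R id_blinfun + (1 - d) *\<^sub>R B"
    by (simp add: D_eq)
  then have D: "D \<in> pos_def"
    using pos_def_convex[OF id_pos_def[of 1] B, of "1 - d"] d by simp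
  have D_fun: "op_fun (\<lambda>x. d + (1 - d) * x) B = D"
    unfolding D_def by (rule op_fun_eq_op_poly[OF mM(2)]) simp
  have "F o\<^sub>L D = op_fun (\<lambda>x. mean_fun s t x * (d + (1 - d) * x)) B"
    unfolding F_def D_fun[symmetric]
    by (rule op_fun_mult[OF mM(2) cont]) (intro continuous_intros)
  also have "\<dots> = op_poly [:d - t, 1 - d + t:] B"
  proof (rule op_fun_eq_op_poly[OF mM(2)])
    fix x assume "x \<in> {m..M}"
    then have "(1 - d) * x + d \<noteq> 0"
      using pos[of x] by auto
    then show "mean_fun s t x * (d + (1 - d) * x) = poly [:d - t, 1 - d + t:] x"
      by (simp add: mean field_simps)
  qed
  finally have FD: "F (D x) = (d - t) *\<^sub>R x + (1 - d + t) *\<^sub>R B x" for x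
    by (metis (no_types) op_poly_linear blinfun_apply_blinfun_compose blinfun.add_left
        blinfun.scaleR_left blinfun_apply_id_blinfun)
  define W where "W = (1 - d) *\<^sub>R op_inv X + d *\<^sub>R op_inv A"
  have W: "W \<in> pos_def"
    unfolding W_def using d by (intro pos_def_convex op_inv_pos_def X A) auto
  have key: "W (A (R x)) = R (D x)" for x
    by (simp add: W_def D_eq B_def blinfun.bilinear_simps op_inv_apply[OF A] RR add.commute)
  have H: "harm_mean d X A (R (D x)) = A (R x)" for x
    unfolding harm_mean_def W_def[symmetric] key[symmetric] by (rule op_inv_apply(1)[OF W])
  \<comment> \<open>compare both sides after composing with the invertible denominator \<open>D\<close>\<close>
  have F: "F y = (1 - t / d) *\<^sub>R y + (t / d) *\<^sub>R R (harm_mean d X A (R y))" for y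
  proof -
    define x where "x = op_inv D y"
    have y: "y = D x"
      by (simp add: x_def op_inv_apply[OF D])
    have "(1 - t / d) *\<^sub>R D x + (t / d) *\<^sub>R R (harm_mean d X A (R (D x)))
        = (1 - t / d) *\<^sub>R (d *\<^sub>R x + (1 - d) *\<^sub>R B x) + (t / d) *\<^sub>R B x"
      unfolding H by (simp add: D_eq B_def blinfun.bilinear_simps)
    also have "\<dots> = ((1 - t / d) * d) *\<^sub>R x + ((1 - t / d) * (1 - d) + t / d) *\<^sub>R B x"
      by (simp add: scaleR_add_left scaleR_add_right)
    also have "(1 - t / d) * d = d - t"
      using d by (simp add: field_simps)
    also have "(1 - t / d) * (1 - d) + t / d = 1 - d + t"
      using d by (simp add: field_simps)
    finally show ?thesis
      unfolding y FD ..
  qed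
  show ?thesis
  proof (rule blinfun_eqI)
    fix x
    have "op_mean s t X A x = S (F (S x))"
      by (simp add: op_mean_def Let_def S_def R_def F_def B_def)
    also have "\<dots> = (1 - t / d) *\<^sub>R X x + (t / d) *\<^sub>R harm_mean d X A x"
      by (simp add: F blinfun.bilinear_simps RS)
    finally show "op_mean s t X A x = ((1 - t / d) *\<^sub>R X + (t / d) *\<^sub>R harm_mean d X A) x"
      by (simp add: blinfun.bilinear_simps)
  qed
qed

lemma harm_mean_pos_def:
  "X \<in> pos_def \<Longrightarrow> A \<in> pos_def \<Longrightarrow> 0 \<le> d \<Longrightarrow> d \<le> 1 \<Longrightarrow> harm_mean d X A \<in> pos_def"
  unfolding harm_mean_def by (intro op_inv_pos_def pos_def_convex)

lemma harm_mean_mono_form: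
  assumes "X \<in> pos_def" "Y \<in> pos_def" "A \<in> pos_def" "B \<in> pos_def" "0 \<le> d" "d \<le> 1"
    and "\<And>x. inner (blinfun_apply X x) x \<le> inner (blinfun_apply Y x) x"
    and "\<And>x. inner (blinfun_apply A x) x \<le> inner (blinfun_apply B x) x"
  shows "inner (blinfun_apply (harm_mean d X A) x) x \<le> inner (blinfun_apply (harm_mean d Y B) x) x"
  unfolding harm_mean_def
proof (rule op_inv_antitone_form)
  fix x
  have "inner (op_inv Y x) x \<le> inner (op_inv X x) x" "inner (op_inv B x) x \<le> inner (op_inv A x) x"
    using assms by (auto intro: op_inv_antitone_form)
  then have "(1 - d) * inner (op_inv Y x) x + d * inner (op_inv B x) x
      \<le> (1 - d) * inner (op_inv X x) x + d * inner (op_inv A x) x"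
    using assms(5,6) by (intro add_mono mult_left_mono) auto
  then show "inner (((1 - d) *\<^sub>R op_inv Y + d *\<^sub>R op_inv B) x) x
      \<le> inner (((1 - d) *\<^sub>R op_inv X + d *\<^sub>R op_inv A) x) x"
    by (simp add: blinfun.bilinear_simps inner_simps)
qed (use assms in \<open>auto intro!: pos_def_convex op_inv_pos_def\<close>)

lemma harm_mean_same:
  assumes "X \<in> pos_def"
  shows "harm_mean d X X = X"
  unfolding harm_mean_def by (simp add: op_inv_op_inv assms flip: scaleR_add_left)

lemma harm_mean_le_arith_mean_form:
  assumes "X \<in> pos_def" "A \<in> pos_def" "0 \<le> d" "d \<le> 1"
  shows "inner (blinfun_apply (harm_mean d X A) x) x
    \<le> (1 - d) * inner (blinfun_apply X x) x + d * inner (blinfun_apply A x) x"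
  using op_inv_convex_form[of "op_inv X" "op_inv A" d x] assms
  by (simp add: harm_mean_def op_inv_pos_def op_inv_op_inv)

text \<open>
  In the coordinate \<open>Z \<mapsto> Z\<^sup>-\<^sup>1\<close> weighted harmonic means with \<open>X\<close> run along a segment starting at
  \<open>X\<^sup>-\<^sup>1\<close>, so that the weights multiply.
\<close>

lemma harm_mean_harm_mean:
  assumes "X \<in> pos_def" "A \<in> pos_def" "0 \<le> d" "d \<le> 1"
  shows "harm_mean k X (harm_mean d X A) = harm_mean (k * d) X A"
proof -
  define W where "W = (1 - d) *\<^sub>R op_inv X + d *\<^sub>R op_inv A"
  have W: "W \<in> pos_def"
    unfolding W_def by (intro pos_def_convex op_inv_pos_def assms)
  have "(1 - k) *\<^sub>R op_inv X + k *\<^sub>R W = (1 - k * d) *\<^sub>R op_inv X + (k * d) *\<^sub>R op_inv A"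
    by (simp add: W_def scaleR_add_right algebra_simps)
  then show ?thesis
    by (simp add: harm_mean_def op_inv_op_inv[OF W] flip: W_def)
qed

section \<open>Monotonicity and contraction of the means\<close>

locale mean_parameters =
  fixes s t :: real
  assumes s: "0 \<le> s" "s \<le> 1" and t: "0 < t" "t \<le> 1"
begin

abbreviation "d \<equiv> harm_weight s t"

lemma d: "0 \<le> d" "d \<le> 1" "0 < d" "t \<le> d" "0 \<le> t / d" "t / d \<le> 1" "t \<le> t / d"
proof -
  note * = harm_weight_bounds[OF s t]
  show "0 \<le> d" "d \<le> 1" "0 < d" "t \<le> d" "0 \<le> t / d" "t / d \<le> 1"
    using * t by (auto intro!: divide_nonneg_pos)
  show "t \<le> t / d"
    using * t by (simp add: pos_le_divide_eq mult_le_cancel_left1)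
qed

lemma op_mean_form:
  assumes "X \<in> pos_def" "A \<in> pos_def"
  shows "inner (blinfun_apply (op_mean s t X A) x) x
    = (1 - t / d) * inner (blinfun_apply X x) x + (t / d) * inner (blinfun_apply (harm_mean d X A) x) x"
  by (simp add: op_mean_eq_harm_mean[OF s t assms] blinfun.bilinear_simps inner_simps)

lemma op_mean_pos_def: "X \<in> pos_def \<Longrightarrow> A \<in> pos_def \<Longrightarrow> op_mean s t X A \<in> pos_def"
  unfolding op_mean_eq_harm_mean[OF s t] using d by (intro pos_def_convex harm_mean_pos_def)

lemma op_mean_same: "X \<in> pos_def \<Longrightarrow> op_mean s t X X = X"
  by (simp add: op_mean_eq_harm_mean[OF s t] harm_mean_same flip: scaleR_add_left)

lemma op_mean_mono:
  assumes P: "X \<in> pos_def" "Y \<in> pos_def" "A \<in> pos_def" "B \<in> pos_def" and le: "op_le X Y" "op_le A B"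
  shows "op_le (op_mean s t X A) (op_mean s t Y B)"
proof -
  have "inner (op_mean s t X A x) x \<le> inner (op_mean s t Y B x) x" for x
    unfolding op_mean_form[OF P(1,3)] op_mean_form[OF P(2,4)]
    using le d by (intro add_mono mult_left_mono harm_mean_mono_form P)
      (auto simp: op_le_pos_def_iff P)
  then show ?thesis
    by (simp add: op_le_pos_def_iff op_mean_pos_def P)
qed

lemma op_mean_op_box:
  assumes "X \<in> op_box m M" "A \<in> op_box m M" "0 < m" "0 < M"
  shows "op_mean s t X A \<in> op_box m M"
proof -
  have P: "X \<in> pos_def" "A \<in> pos_def"
    using assms op_box_pos_def by blast+
  have "op_le (op_mean s t (m *\<^sub>R id_blinfun) (m *\<^sub>R id_blinfun)) (op_mean s t X A)"
    "op_le (op_mean s t X A) (op_mean s t (M *\<^sub>R id_blinfun) (M *\<^sub>R id_blinfun))"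
    using assms P by (auto intro!: op_mean_mono id_pos_def simp: op_box_iff_op_le)
  then show ?thesis
    by (simp add: op_box_iff_op_le op_mean_same id_pos_def assms pos_def_self_adjoint op_mean_pos_def P)
qed

end

text \<open>
  \<open>(M(X, A) - X) / t = (H\<^sub>d(X, A) - X) / d\<close> increases with \<open>d\<close>, hence with \<open>t\<close>: for
  \<open>d = k d'\<close>, \<open>k \<le> 1\<close>, \<open>H\<^sub>d(X, A) = H\<^sub>k(X, H\<^sub>d\<^sub>'(X, A)) \<le> (1 - k) X + k H\<^sub>d\<^sub>'(X, A)\<close>.
\<close>

lemma op_mean_parameter_mono:
  assumes s: "0 \<le> s" "s \<le> 1" and t: "0 < t" "t \<le> t'" "t' \<le> 1" and P: "X \<in> pos_def" "A \<in> pos_def"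
  shows "op_le (op_mean s t X A) ((1 - t / t') *\<^sub>R X + (t / t') *\<^sub>R op_mean s t' X A)"
proof -
  interpret a: mean_parameters s t
    using assms by unfold_locales auto
  interpret b: mean_parameters s t'
    using assms by unfold_locales auto
  define k where "k = a.d / b.d"
  have "a.d \<le> b.d"
  proof -
    have "t * (1 - s) \<le> t' * (1 - s)"
      using s t by (intro mult_right_mono) auto
    then show ?thesis
      by (simp add: algebra_simps)
  qed
  then have k: "0 \<le> k" "k \<le> 1" "k * b.d = a.d"
    using a.d b.d by (auto simp: k_def)
  have "inner (op_mean s t X A x) x
    \<le> (1 - t / t') * inner (X x) x + (t / t') * inner (op_mean s t' X A x) x" for x
  proof -
    let ?H = "inner (harm_mean b.d X A x) x"
    have "inner (harm_mean a.d X A x) x \<le> (1 - k) * inner (X x) x + k * ?H"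
      using harm_mean_le_arith_mean_form[of X "harm_mean b.d X A" k x] P k b.d
      by (simp add: harm_mean_harm_mean harm_mean_pos_def)
    then have "(t / a.d) * inner (harm_mean a.d X A x) x
        \<le> (t / a.d) * ((1 - k) * inner (X x) x + k * ?H)"
      using a.d by (intro mult_left_mono) auto
    then have "inner (op_mean s t X A x) x
        \<le> (1 - t / a.d) * inner (X x) x + (t / a.d) * ((1 - k) * inner (X x) x + k * ?H)"
      unfolding a.op_mean_form[OF P] by linarith
    also have "\<dots> = (1 - t / a.d * k) * inner (X x) x + (t / a.d * k) * ?H"
      by (simp add: algebra_simps)
    also have "t / a.d * k = t / b.d"
      using a.d by (simp add: k_def)
    also have "(1 - t / b.d) * inner (X x) x + (t / b.d) * ?H
        = (1 - t / t') * inner (X x) x + (t / t') * ((1 - t' / b.d) * inner (X x) x + (t' / b.d) * ?H)"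
    proof -
      have "(1 - t / c) * y + (t / c) * z = (1 - t / t') * y + (t / t') * ((1 - t' / c) * y + (t' / c) * z)"
        if "c \<noteq> 0" for c y z :: real
        using that b.t by (simp add: field_simps)
      then show ?thesis
        using b.d by simp
    qed
    finally show ?thesis
      unfolding b.op_mean_form[OF P] .
  qed
  then show ?thesis
    using P by (simp add: op_le_iff a.op_mean_pos_def b.op_mean_pos_def pos_def_self_adjoint
        self_adjoint_intros blinfun.bilinear_simps inner_simps)
qed

text \<open>
  With \<open>u = t e\<close> and \<open>\<theta> = 1 / (1 + u)\<close> this is \<open>\<theta> (1 + u \<theta>)\<close>: the harmonic part of the mean contracts
  with rate \<open>\<theta>\<close>, and mixing it with the rigid part \<open>(1 - t/d) X\<close> moves the rate to the weighted
  average \<open>(1 + u \<theta>) / (1 + u)\<close> of \<open>1\<close> and \<open>\<theta>\<close>.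
\<close>

definition contraction_rate :: "real \<Rightarrow> real \<Rightarrow> real"
  where "contraction_rate e t = (1 + t * e * (1 / (1 + t * e))) / (1 + t * e)"

lemma contraction_rate_bounds:
  assumes "0 < e" "0 < t"
  shows "0 \<le> contraction_rate e t" "contraction_rate e t < 1"
proof -
  define u where "u = t * e"
  have "0 < u"
    using assms by (simp add: u_def)
  then show "0 \<le> contraction_rate e t"
    unfolding contraction_rate_def u_def[symmetric] by simp
  have "u * (1 / (1 + u)) < u * 1"
    using \<open>0 < u\<close> by (intro mult_strict_left_mono) auto
  then show "contraction_rate e t < 1"
    unfolding contraction_rate_def u_def[symmetric] using \<open>0 < u\<close>
    by (subst divide_less_eq_1_pos) auto
qed

text \<open>
  Strict contraction in the Thompson metric on bounded sets.  With \<open>e = m / M\<close>,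
  \<open>e X \<le> A \<le> X / e\<close>; hence scaling \<open>X\<close> alone by \<open>r\<close> scales \<open>H\<^sub>d(X, A)\<close> by at most the smaller factor
  \<open>1 + \<theta> (r - 1)\<close>, and the harmonic part \<open>(t/d) H\<^sub>d(X, A) \<ge> t e X\<close> is large enough to pass a share of
  this gain on to the mean.
\<close>

lemma op_mean_scale_le:
  assumes "mean_parameters s t"
    and X: "X \<in> op_box m M" and A: "A \<in> op_box m M" and m: "0 < m" "m \<le> M" and r: "1 \<le> r"
  shows "op_le (op_mean s t (r *\<^sub>R X) A)
    ((1 + contraction_rate (m / M) t * (r - 1)) *\<^sub>R op_mean s t X A)"
proof -
  interpret mean_parameters s t by fact
  define e where "e = m / M"
  have e: "0 < e" "e \<le> 1"
    using m by (auto simp: e_def)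
  define \<theta> where "\<theta> = 1 / (1 + t * e)"
  define r' where "r' = 1 + \<theta> * (r - 1)"
  define r'' where "r'' = 1 + contraction_rate e t * (r - 1)"
  have te: "0 < t * e"
    using e t by simp
  have \<theta>: "0 < \<theta>" "\<theta> * (1 + t * e) = 1"
    using te by (auto simp: \<theta>_def add_pos_pos)
  have r': "1 \<le> r'"
    using \<theta> r by (simp add: r'_def)
  have rr': "r - r' = (1 - \<theta>) * (r - 1)" "0 \<le> r - r'"
  proof -
    show *: "r - r' = (1 - \<theta>) * (r - 1)"
      by (simp add: r'_def algebra_simps)
    have "\<theta> \<le> 1"
      using te by (simp add: \<theta>_def)
    then show "0 \<le> r - r'"
      unfolding * using r by simp
  qed
  have P: "X \<in> pos_def" "A \<in> pos_def" "r *\<^sub>R X \<in> pos_def"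
    using X A m r op_box_pos_def[of _ m M] pos_def_scaleR[of X r] by auto
  have XA: "e * inner (X x) x \<le> inner (A x) x" for x
  proof -
    have "e * inner (X x) x \<le> e * (M * (norm x)\<^sup>2)"
      using op_box_upper[OF X] e by (intro mult_left_mono) auto
    also have "\<dots> = m * (norm x)\<^sup>2"
      using m by (simp add: e_def)
    also have "\<dots> \<le> inner (A x) x"
      using op_box_lower[OF A] .
    finally show ?thesis .
  qed
  have AX: "e * inner (A x) x \<le> inner (X x) x" for x
  proof -
    have "e * inner (A x) x \<le> e * (M * (norm x)\<^sup>2)"
      using op_box_upper[OF A] e by (intro mult_left_mono) auto
    also have "\<dots> = m * (norm x)\<^sup>2"
      using m by (simp add: e_def)
    also have "\<dots> \<le> inner (X x) x"
      using op_box_lower[OF X] .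
    finally show ?thesis .
  qed
  have invAX: "e * inner (op_inv X x) x \<le> inner (op_inv A x) x" for x
  proof -
    have "inner (op_inv ((1 / e) *\<^sub>R X) x) x \<le> inner (op_inv A x) x"
      using AX e by (intro op_inv_antitone_form pos_def_scaleR P)
        (auto simp: blinfun.bilinear_simps field_simps)
    then show ?thesis
      using e by (simp add: op_inv_scaleR P blinfun.bilinear_simps)
  qed
  have X0: "0 \<le> inner (op_inv X x) x" for x
    by (intro pos_def_inner_ge_0 op_inv_pos_def P)
  have H: "inner (harm_mean d (r *\<^sub>R X) A x) x \<le> r' * inner (harm_mean d X A x) x" for x
  proof -
    define W where "W = (1 - d) *\<^sub>R op_inv X + d *\<^sub>R op_inv A"
    have W: "W \<in> pos_def"
      unfolding W_def using d by (intro pos_def_convex op_inv_pos_def P)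
    define V where "V = (1 - d) *\<^sub>R op_inv (r *\<^sub>R X) + d *\<^sub>R op_inv A"
    have V: "V \<in> pos_def"
      unfolding V_def using d by (intro pos_def_convex op_inv_pos_def P)
    have "inner (op_inv V x) x \<le> inner (op_inv ((1 / r') *\<^sub>R W) x) x"
    proof (rule op_inv_antitone_form)
      show "(1 / r') *\<^sub>R W \<in> pos_def"
        using r' W by (intro pos_def_scaleR) auto
      fix y
      let ?p = "inner (op_inv X y) y" and ?q = "inner (op_inv A y) y"
      have "(1 - d) * (r - r') \<le> d * (r' - 1) * e * r"
      proof -
        have "(1 - d) * (r - r') \<le> 1 * (r - r')"
          using d rr' by (intro mult_right_mono) auto
        also have "\<dots> = (1 - \<theta>) * (r - 1)"
          by (simp add: rr'(1))
        also have "1 - \<theta> = \<theta> * (t * e)"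
          using \<theta>(2) by (simp add: algebra_simps)
        also have "\<theta> * (t * e) * (r - 1) = t * (r' - 1) * e"
          by (simp add: r'_def)
        also have "\<dots> \<le> d * (r' - 1) * e"
          using d r' e by (intro mult_right_mono) auto
        also have "\<dots> \<le> d * (r' - 1) * e * r"
        proof -
          have "0 \<le> d * (r' - 1) * e"
            using d r' e by simp
          from mult_left_mono[OF r this] show ?thesis
            by (simp only: mult_1_right)
        qed
        finally show ?thesis .
      qed
      then have "(1 - d) * (r - r') * ?p \<le> d * (r' - 1) * e * r * ?p"
        using X0 by (intro mult_right_mono)
      also have "\<dots> = d * (r' - 1) * r * (e * ?p)"
        by simp
      also have "\<dots> \<le> d * (r' - 1) * r * ?q"
        using d r' r invAX by (intro mult_left_mono) auto
      finally have *: "(1 - d) * (r - r') * ?p \<le> d * (r' - 1) * r * ?q" .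
      have "r * ((1 - d) * ?p + d * ?q) \<le> r' * ((1 - d) * ?p + d * r * ?q)"
        using * by (simp add: algebra_simps)
      then have "(1 / r') * ((1 - d) * ?p + d * ?q) \<le> (1 - d) * (1 / r * ?p) + d * ?q"
        using r r' by (simp add: field_simps)
      then show "inner (((1 / r') *\<^sub>R W) y) y \<le> inner (V y) y"
        using r by (simp add: W_def V_def op_inv_scaleR P blinfun.bilinear_simps inner_simps)
    qed (rule V)
    then show ?thesis
      using r' by (simp add: op_inv_scaleR W harm_mean_def blinfun.bilinear_simps flip: W_def V_def)
  qed
  have XH: "e * inner (X x) x \<le> inner (harm_mean d X A x) x" for x
  proof -
    have "inner (harm_mean d (e *\<^sub>R X) (e *\<^sub>R X) x) x \<le> inner (harm_mean d X A x) x"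
    proof (rule harm_mean_mono_form)
      show "inner ((e *\<^sub>R X) x) x \<le> inner (X x) x" for x
        using e pos_def_inner_ge_0[OF P(1), of x] by (simp add: blinfun.bilinear_simps mult_left_le_one_le)
    qed (use P e d XA in \<open>auto intro: pos_def_scaleR simp: blinfun.bilinear_simps\<close>)
    then show ?thesis
      using e P by (simp add: harm_mean_same pos_def_scaleR blinfun.bilinear_simps)
  qed
  have "inner (op_mean s t (r *\<^sub>R X) A x) x \<le> r'' * inner (op_mean s t X A x) x" for x
  proof -
    let ?X = "inner (X x) x" and ?H = "inner (harm_mean d X A x) x"
    have X0': "0 \<le> ?X"
      by (rule pos_def_inner_ge_0[OF P(1)])
    have rate: "contraction_rate e t = \<theta> * (1 + t * e * \<theta>)"
      by (simp add: contraction_rate_def \<theta>_def)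
    have r'': "r - r'' = (t * e) * (r'' - r')" "0 \<le> r - r''"
    proof -
      have a: "1 - contraction_rate e t = t * e * (contraction_rate e t - \<theta>)"
      proof -
        have "contraction_rate e t * (1 + t * e) = (\<theta> * (1 + t * e)) * (1 + t * e * \<theta>)"
          unfolding rate by (simp only: mult_ac)
        then have "contraction_rate e t * (1 + t * e) = 1 + t * e * \<theta>"
          unfolding \<theta>(2) by simp
        then show ?thesis
          by (simp add: algebra_simps)
      qed
      have "r - r'' = (1 - contraction_rate e t) * (r - 1)"
        by (simp add: r''_def algebra_simps)
      moreover have "r'' - r' = (contraction_rate e t - \<theta>) * (r - 1)"
        by (simp add: r''_def r'_def algebra_simps)
      ultimately show "r - r'' = (t * e) * (r'' - r')"
        using a by simp
      show "0 \<le> r - r''"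
        using \<open>r - r'' = (1 - contraction_rate e t) * (r - 1)\<close> contraction_rate_bounds[OF e(1) t(1)] r
        by simp
    qed
    have "r'' - r' \<ge> 0"
      using r'' te by (metis zero_le_mult_iff less_le_not_le)
    have "(1 - t / d) * (r - r'') * ?X \<le> 1 * (r - r'') * ?X"
      using d r'' X0' by (intro mult_right_mono) auto
    also have "\<dots> = t * ((r'' - r') * (e * ?X))"
      using r'' by simp
    also have "\<dots> \<le> (t / d) * ((r'' - r') * ?H)"
      using d \<open>r'' - r' \<ge> 0\<close> XH e X0' t by (intro mult_mono mult_left_mono mult_nonneg_nonneg) auto
    finally have *: "(1 - t / d) * (r - r'') * ?X \<le> (t / d) * ((r'' - r') * ?H)" .
    have "inner (op_mean s t (r *\<^sub>R X) A x) x
        \<le> (1 - t / d) * (r * ?X) + (t / d) * (r' * ?H)"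
      unfolding op_mean_form[OF P(3,2)] using H[of x] d
      by (intro add_mono mult_left_mono) (auto simp: blinfun.bilinear_simps)
    also have "\<dots> \<le> r'' * ((1 - t / d) * ?X + (t / d) * ?H)"
    proof -
      have "u * (r * y) + v * (r' * h) \<le> r'' * (u * y + v * h)"
        if "u * (r - r'') * y \<le> v * ((r'' - r') * h)" for u v y h :: real
        using that by (simp add: algebra_simps)
      from this[OF *] show ?thesis .
    qed
    finally show ?thesis
      unfolding op_mean_form[OF P(1,2)] .
  qed
  then show ?thesis
    unfolding e_def[symmetric] r''_def[symmetric]
    by (simp add: op_le_iff op_mean_pos_def P pos_def_self_adjoint self_adjoint_intros blinfun.bilinear_simps)
qed

section \<open>Weak integrals of operators\<close>

text \<open>
  The representing vector is the minimiser of \<open>\<parallel>y\<parallel>\<^sup>2 - 2 \<phi>(y)\<close>; minimising sequences are Cauchy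
  by the parallelogram law.
\<close>

lemma Riesz_representation:
  fixes \<phi> :: "'a::{real_inner,banach} \<Rightarrow> real"
  assumes "bounded_linear \<phi>"
  shows "\<exists>z. \<forall>y. \<phi> y = inner z y"
proof -
  interpret bounded_linear \<phi> by fact
  define J where "J y = (norm y)\<^sup>2 - 2 * \<phi> y" for y
  obtain K where K: "\<And>y. \<bar>\<phi> y\<bar> \<le> norm y * K"
    using bounded by (auto simp: real_norm_def)
  have "- (K\<^sup>2) \<le> J y" for y
    using K[of y] sum_squares_ge_zero[of "norm y - K" 0]
    by (simp add: J_def power2_eq_square algebra_simps abs_le_iff)
  then have bdd: "bdd_below (range J)"
    by (auto intro!: bdd_belowI)
  define I where "I = Inf (range J)"
  have I: "I \<le> J y" for y
    unfolding I_def using bdd by (auto intro: cInf_lower)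
  have "\<exists>y. J y < I + inverse (Suc n)" for n
    using cInf_lessD[of "range J" "I + inverse (Suc n)"] by (auto simp: I_def)
  then obtain y where y: "\<And>n. J (y n) < I + inverse (Suc n)"
    by metis
  have gap: "(norm (y n - y k))\<^sup>2 \<le> 2 * inverse (Suc n) + 2 * inverse (Suc k)" for n k
  proof -
    have "(norm (y n - y k))\<^sup>2 = 2 * J (y n) + 2 * J (y k) - 4 * J ((1/2) *\<^sub>R (y n + y k))"
      unfolding J_def power2_norm_eq_inner by (simp add: add scaleR inner_simps algebra_simps inner_commute)
    then show ?thesis
      using y[of n] y[of k] I[of "(1/2) *\<^sub>R (y n + y k)"] by linarith
  qed
  have "Cauchy y"
  proof (rule metric_CauchyI)
    fix e :: real assume e: "0 < e"
    then obtain N where N: "inverse (real (Suc N)) < e\<^sup>2 / 4"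
      using reals_Archimedean[of "e\<^sup>2 / 4"] by auto
    have "dist (y n) (y k) < e" if "n \<ge> N" "k \<ge> N" for n k
    proof -
      have "inverse (real (Suc n)) \<le> inverse (real (Suc N))" "inverse (real (Suc k)) \<le> inverse (real (Suc N))"
        using that by (auto intro!: le_imp_inverse_le)
      then have "(norm (y n - y k))\<^sup>2 < e\<^sup>2"
        using gap[of n k] N by linarith
      then show ?thesis
        using e power2_less_imp_less[of "norm (y n - y k)" e] by (simp add: dist_norm)
    qed
    then show "\<exists>N. \<forall>n\<ge>N. \<forall>k\<ge>N. dist (y n) (y k) < e"
      by blast
  qed
  then obtain z where z: "y \<longlonglongrightarrow> z"
    using Cauchy_convergent convergent_def by blast
  have "(\<lambda>n. J (y n)) \<longlonglongrightarrow> J z"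
    unfolding J_def by (intro tendsto_intros z tendsto)
  moreover have "(\<lambda>n. I + inverse (Suc n)) \<longlonglongrightarrow> I + 0"
    by (intro tendsto_intros LIMSEQ_inverse_real_of_nat)
  ultimately have "J z \<le> I + 0"
    by (rule LIMSEQ_le) (use y in \<open>auto intro: less_imp_le\<close>)
  then have min: "J z \<le> J x" for x
    using I[of x] by linarith
  have "\<phi> x = inner z x" for x
  proof (cases "x = 0")
    case False
    define a where "a = inner z x - \<phi> x"
    define r where "r = a / (norm x)\<^sup>2"
    have "J (z - r *\<^sub>R x) = J z - 2 * r * a + r\<^sup>2 * (norm x)\<^sup>2"
      unfolding J_def power2_norm_eq_inner a_def
      by (simp add: diff scaleR inner_simps power2_eq_square algebra_simps inner_commute)
    also have "\<dots> = J z - a\<^sup>2 / (norm x)\<^sup>2"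
      using False by (simp add: r_def power2_eq_square field_simps)
    finally have "a\<^sup>2 / (norm x)\<^sup>2 \<le> 0"
      using min[of "z - r *\<^sub>R x"] by linarith
    then have "a = 0"
      using False by (simp add: divide_le_0_iff)
    then show ?thesis
      by (simp add: a_def)
  qed (simp add: zero)
  then show ?thesis
    by blast
qed

text \<open>
  The real parts decide, since \<open>cinner x y = inner x y + \<i> inner x (\<i> y)\<close>.
\<close>

lemma has_weak_integral_iff_inner:
  "has_weak_integral g T M \<longleftrightarrow> T \<in> self_adjoint \<and>
    (\<forall>x y. integrable M (\<lambda>\<omega>. inner (blinfun_apply (g \<omega>) x) y) \<and>
           inner (blinfun_apply T x) y = (\<integral>\<omega>. inner (blinfun_apply (g \<omega>) x) y \<partial>M))"
  (is "?L \<longleftrightarrow> ?R")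
proof
  assume ?L
  then show ?R
    by (auto simp: has_weak_integral_def inner_eq_Re_cinner)
next
  assume R: ?R
  have split: "cinner a b = of_real (inner a b) + \<i> * of_real (inner a (\<i> *\<^sub>C b))" for a b :: 'b
    by (simp add: complex_eq_iff Im_cinner inner_eq_Re_cinner[symmetric])
  have int: "integrable M (\<lambda>\<omega>. complex_of_real (inner (blinfun_apply (g \<omega>) x) y))" for x y
    using R by (intro integrable_of_real) auto
  show ?L
    unfolding has_weak_integral_def
  proof (intro conjI allI)
    fix x y
    show "integrable M (\<lambda>\<omega>. cinner (blinfun_apply (g \<omega>) x) y)"
      unfolding split by (intro Bochner_Integration.integrable_add integrable_mult_right int)
    show "cinner (blinfun_apply T x) y = (\<integral>\<omega>. cinner (blinfun_apply (g \<omega>) x) y \<partial>M)"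
      unfolding split using R
      by (simp add: Bochner_Integration.integral_add int)
  qed (use R in simp)
qed

lemma has_weak_integral_unique:
  assumes "has_weak_integral g T M" "has_weak_integral g U M"
  shows "T = U"
proof (rule blinfun_eqI)
  show "T x = U x" for x
    using assms unfolding has_weak_integral_iff_inner by (metis vector_eq_rdot)
qed

lemma has_weak_integral_mono:
  assumes g: "has_weak_integral g T M" and h: "has_weak_integral h U M"
    and le: "AE \<omega> in M. op_le (g \<omega>) (h \<omega>)"
  shows "op_le T U"
proof -
  have sa: "T \<in> self_adjoint" "U \<in> self_adjoint"
    using g h by (auto simp: has_weak_integral_def)
  have "inner (T x) x \<le> inner (U x) x" for x
  proof -
    have "(\<integral>\<omega>. inner (g \<omega> x) x \<partial>M) \<le> (\<integral>\<omega>. inner (h \<omega> x) x \<partial>M)"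
    proof (rule integral_mono_AE)
      show "AE \<omega> in M. inner (g \<omega> x) x \<le> inner (h \<omega> x) x"
        using le by eventually_elim
          (simp add: op_le_def pos_semidef_def blinfun.bilinear_simps inner_simps flip: inner_eq_Re_cinner)
    qed (use g h in \<open>auto simp: has_weak_integral_iff_inner\<close>)
    then show ?thesis
      using g h by (simp add: has_weak_integral_iff_inner)
  qed
  then show ?thesis
    by (simp add: op_le_iff sa)
qed

lemma has_weak_integral_affine:
  assumes "prob_space M" "C \<in> self_adjoint" "has_weak_integral g T M"
  shows "has_weak_integral (\<lambda>\<omega>. C + r *\<^sub>R g \<omega>) (C + r *\<^sub>R T) M"
proof -
  interpret prob_space M by fact
  show ?thesis
    using assms(2,3)
    by (simp add: has_weak_integral_iff_inner self_adjoint_intros blinfun.bilinear_simps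
        inner_simps prob_space)
qed

lemma has_weak_integral_scaleR:
  assumes "prob_space M" "has_weak_integral g T M"
  shows "has_weak_integral (\<lambda>\<omega>. r *\<^sub>R g \<omega>) (r *\<^sub>R T) M"
  using has_weak_integral_affine[OF assms(1) self_adjoint_zero assms(2)] by simp

lemma has_weak_integral_op_box:
  fixes T :: "'a::complex_hilbert \<Rightarrow>\<^sub>L 'a"
  assumes "prob_space M" "has_weak_integral g T M" "AE \<omega> in M. g \<omega> \<in> op_box m K"
  shows "T \<in> op_box m K"
proof -
  have const: "has_weak_integral (\<lambda>_. C) C M" if "C \<in> self_adjoint" for C :: "'a \<Rightarrow>\<^sub>L 'a"
    using has_weak_integral_affine[OF assms(1) that assms(2), of 0] by simp
  have "op_le (m *\<^sub>R id_blinfun) T"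
    by (rule has_weak_integral_mono[OF const assms(2)])
      (use assms(3) in \<open>auto simp: op_box_iff_op_le self_adjoint_intros elim: eventually_mono\<close>)
  moreover have "op_le T (K *\<^sub>R id_blinfun)"
    by (rule has_weak_integral_mono[OF assms(2) const])
      (use assms(3) in \<open>auto simp: op_box_iff_op_le self_adjoint_intros elim: eventually_mono\<close>)
  ultimately show ?thesis
    using assms(2) by (simp add: op_box_iff_op_le has_weak_integral_def)
qed

text \<open>
  For fixed \<open>x\<close> the functional \<open>y \<mapsto> \<integral> \<langle>g x, y\<rangle>\<close> is bounded because \<open>\<parallel>g\<parallel> \<le> K\<close> almost everywhere; its
  Riesz vector depends linearly on \<open>x\<close>.  Only the scalar functions \<open>\<langle>g x, y\<rangle>\<close> enter, which
  covers nonseparable spaces.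
\<close>

lemma has_weak_integral_exists:
  fixes g :: "'b \<Rightarrow> ('a::complex_hilbert \<Rightarrow>\<^sub>L 'a)"
  assumes "prob_space M"
    and meas: "\<And>x y. (\<lambda>\<omega>. inner (blinfun_apply (g \<omega>) x) y) \<in> borel_measurable M"
    and box: "AE \<omega> in M. g \<omega> \<in> op_box m K" and K: "0 \<le> m" "0 \<le> K"
  shows "\<exists>T. has_weak_integral g T M"
proof -
  interpret prob_space M by fact
  have bound: "AE \<omega> in M. \<bar>inner (g \<omega> x) y\<bar> \<le> K * norm x * norm y" for x y
    using box
  proof eventually_elim
    case (elim \<omega>)
    have "norm (g \<omega> x) \<le> K * norm x"
      by (rule order_trans[OF norm_blinfun mult_right_mono[OF op_box_norm_le[OF elim K] norm_ge_zero]])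
    then have "norm (g \<omega> x) * norm y \<le> K * norm x * norm y"
      by (rule mult_right_mono) simp
    then show ?case
      by (rule order_trans[OF Cauchy_Schwarz_ineq2])
  qed
  have int: "integrable M (\<lambda>\<omega>. inner (g \<omega> x) y)" for x y
    using bound[of x y] by (intro integrable_const_bound[OF _ meas]) simp
  define \<phi> where "\<phi> x y = (\<integral>\<omega>. inner (g \<omega> x) y \<partial>M)" for x y
  have \<phi>_bound: "\<bar>\<phi> x y\<bar> \<le> K * norm x * norm y" for x y
  proof -
    have "\<bar>\<phi> x y\<bar> \<le> (\<integral>\<omega>. \<bar>inner (g \<omega> x) y\<bar> \<partial>M)"
      unfolding \<phi>_def by (rule integral_abs_bound)
    also have "\<dots> \<le> (\<integral>\<omega>. K * norm x * norm y \<partial>M)"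
      by (rule integral_mono_AE) (use int bound in auto)
    finally show ?thesis
      by (simp add: prob_space)
  qed
  have "bounded_linear (\<phi> x)" for x
  proof (rule bounded_linear_intro)
    show "\<phi> x (y + z) = \<phi> x y + \<phi> x z" "\<phi> x (r *\<^sub>R y) = r *\<^sub>R \<phi> x y" for y z r
      unfolding \<phi>_def by (simp_all add: inner_simps int)
    show "norm (\<phi> x y) \<le> norm y * (K * norm x)" for y
      using \<phi>_bound[of x y] by (simp add: mult.commute mult.left_commute)
  qed
  then have "\<exists>z. \<forall>y. \<phi> x y = inner z y" for x
    by (rule Riesz_representation)
  then obtain f where f: "\<And>x y. \<phi> x y = inner (f x) y"
    by metis
  have f_eqI: "f x = v" if "\<And>y. \<phi> x y = inner v y" for x v
    using that unfolding f by (metis vector_eq_rdot)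
  have "bounded_linear f"
  proof (rule bounded_linear_intro)
    show "f (x + y) = f x + f y" "f (r *\<^sub>R x) = r *\<^sub>R f x" for x y r
      by (rule f_eqI, simp add: inner_simps flip: f, simp add: \<phi>_def blinfun.bilinear_simps inner_simps int)+
    show "norm (f x) \<le> norm x * K" for x
    proof (cases "f x = 0")
      case False
      have "norm (f x) * norm (f x) \<le> K * norm x * norm (f x)"
        using \<phi>_bound[of x "f x"] by (simp add: f dot_square_norm power2_eq_square)
      then show ?thesis
        using False by (simp add: mult.commute)
    qed (use K in simp)
  qed
  then have T: "blinfun_apply (Blinfun f) = f"
    by (rule bounded_linear_Blinfun_apply)
  have sa: "AE \<omega> in M. g \<omega> \<in> self_adjoint"
    using box by (auto simp: op_box_def)
  have "Blinfun f \<in> self_adjoint"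
    unfolding self_adjoint_iff_inner T
  proof (intro conjI allI)
    fix x y
    have "\<phi> x y = \<phi> y x"
      unfolding \<phi>_def
      by (rule integral_cong_AE[OF meas meas])
        (use sa in eventually_elim, metis inner_commute self_adjoint_inner)
    then show "inner (f x) y = inner x (f y)"
      by (simp add: f inner_commute)
  next
    fix c x y
    have "\<phi> (c *\<^sub>C x) y = \<phi> x (cnj c *\<^sub>C y)"
      unfolding \<phi>_def
      by (rule integral_cong_AE[OF meas meas])
        (use sa in eventually_elim, simp add: self_adjoint_scaleC inner_scaleC_left)
    then show "inner (f (c *\<^sub>C x)) y = inner (f x) (cnj c *\<^sub>C y)"
      by (simp add: f)
  qed
  then have "has_weak_integral g (Blinfun f) M"
    using int by (simp add: has_weak_integral_iff_inner T \<phi>_def flip: f)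
  then show ?thesis ..
qed

section \<open>Monotone families of operators\<close>

lemma limitin_strong_operator_topology:
  "limitin strong_operator_topology G X F \<longleftrightarrow>
    (\<forall>x. ((\<lambda>t. blinfun_apply (G t) x) \<longlongrightarrow> blinfun_apply X x) F)"
proof -
  have "limitin strong_operator_topology G X F \<longleftrightarrow>
      limitin (euclidean :: ('a \<Rightarrow> 'b) topology) (\<lambda>t. blinfun_apply (G t)) (blinfun_apply X) F"
    by (auto simp: limitin_def strong_operator_topology_def topspace_pullback_topology
        openin_pullback_topology)
  also have "\<dots> \<longleftrightarrow> (\<forall>x. ((\<lambda>t. blinfun_apply (G t) x) \<longlongrightarrow> blinfun_apply X x) F)"
    by (simp add: limitin_componentwise flip: euclidean_product_topology)
  finally show ?thesis .
qed

text \<open>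
  Evaluate the nonnegative form of \<open>D\<close> at \<open>x - Dx / K\<close>.
\<close>

lemma norm_apply_le_form:
  assumes D: "D \<in> op_box 0 K" and K: "0 < K"
  shows "(norm (blinfun_apply D x))\<^sup>2 \<le> K * inner (blinfun_apply D x) x"
proof -
  have sa: "D \<in> self_adjoint"
    using D op_box_self_adjoint by blast
  define y where "y = D x"
  have "inner (D (x - (1 / K) *\<^sub>R y)) (x - (1 / K) *\<^sub>R y)
      = inner y x - 2 / K * (norm y)\<^sup>2 + inner (D y) y / K\<^sup>2"
    using self_adjoint_inner[OF sa, of y x]
    using K by (simp add: blinfun.bilinear_simps inner_simps power2_norm_eq_inner inner_commute
        power2_eq_square[of K] field_simps flip: y_def)
  moreover have "inner (D y) y / K\<^sup>2 \<le> (norm y)\<^sup>2 / K"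
    using op_box_upper[OF D, of y] K by (simp add: field_simps power2_eq_square)
  moreover have "0 \<le> inner (D (x - (1 / K) *\<^sub>R y)) (x - (1 / K) *\<^sub>R y)"
    using op_box_lower[OF D] by simp
  ultimately have "(norm y)\<^sup>2 / K \<le> inner y x"
    by simp
  then show ?thesis
    using K by (simp add: y_def field_simps)
qed

lemma op_box_diff:
  assumes "X \<in> op_box m M" "Y \<in> op_box m M" "0 \<le> m"
    and "\<And>x. inner (blinfun_apply Y x) x \<le> inner (blinfun_apply X x) x"
  shows "X - Y \<in> op_box 0 M"
proof -
  have "inner (X x) x - inner (Y x) x \<le> M * (norm x)\<^sup>2" for x
    using op_box_upper[OF assms(1), of x] op_box_lower[OF assms(2), of x] assms(3)
    by (smt (verit) mult_nonneg_nonneg zero_le_power2)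
  then show ?thesis
    using assms by (auto simp: op_box_def self_adjoint_diff blinfun.bilinear_simps inner_simps)
qed

text \<open>
  Vigier's theorem: the quadratic forms converge by monotonicity, and
  \<open>\<parallel>Dx\<parallel>\<^sup>2 \<le> M \<langle>Dx, x\<rangle>\<close> for \<open>0 \<le> D \<le> M\<close> upgrades this to strong convergence.
\<close>

lemma monotone_strong_limit:
  fixes G :: "real \<Rightarrow> ('a::complex_hilbert \<Rightarrow>\<^sub>L 'a)"
  assumes box: "\<And>t. 0 < t \<Longrightarrow> t \<le> 1 \<Longrightarrow> G t \<in> op_box m M" and m: "0 \<le> m" "0 < M"
    and mono: "\<And>t t'. 0 < t \<Longrightarrow> t \<le> t' \<Longrightarrow> t' \<le> 1 \<Longrightarrow> op_le (G t) (G t')"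
  shows "\<exists>X\<in>op_box m M. limitin strong_operator_topology G X (at_right 0)"
proof -
  define a where "a n = inverse (real (Suc n))" for n
  have a: "0 < a n" "a n \<le> 1" for n
    by (auto simp: a_def field_simps)
  have le: "inner (G t x) x \<le> inner (G t' x) x" if "0 < t" "t \<le> t'" "t' \<le> 1" for t t' x
    using mono[OF that] box[of t] box[of t'] that by (simp add: op_le_iff op_box_self_adjoint)
  have est: "(norm (G t' x - G t x))\<^sup>2 \<le> M * (inner (G t' x) x - inner (G t x) x)"
    if "0 < t" "t \<le> t'" "t' \<le> 1" for t t' x
    using norm_apply_le_form[OF op_box_diff[of "G t'" m M "G t"], of x] box[of t] box[of t'] le[OF that] that m
    by (simp add: blinfun.bilinear_simps inner_simps)
  have "\<exists>v. (\<lambda>n. G (a n) x) \<longlonglongrightarrow> v" for x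
  proof -
    define q where "q n = inner (G (a n) x) x" for n
    have "decseq q"
      unfolding decseq_def q_def using a by (auto intro!: le simp: a_def)
    moreover have "0 \<le> q n" for n
      unfolding q_def using op_box_lower[OF box[OF a(1,2)[of n]], of x] m
      by (smt (verit) mult_nonneg_nonneg zero_le_power2)
    ultimately obtain l where "q \<longlonglongrightarrow> l"
      using decseq_convergent by blast
    then have "Cauchy q"
      using convergent_Cauchy convergent_def by blast
    have "Cauchy (\<lambda>n. G (a n) x)"
    proof (rule metric_CauchyI)
      fix e :: real assume e: "0 < e"
      then have "0 < e\<^sup>2 / M"
        using m by simp
      then obtain N where N: "\<And>i j. i \<ge> N \<Longrightarrow> j \<ge> N \<Longrightarrow> dist (q i) (q j) < e\<^sup>2 / M"
        using metric_CauchyD[OF \<open>Cauchy q\<close>] by blast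
      have *: "dist (G (a i) x) (G (a j) x) < e" if "i \<ge> N" "i \<le> j" for i j
      proof -
        have "(norm (G (a i) x - G (a j) x))\<^sup>2 \<le> M * (q i - q j)"
          unfolding q_def using that a by (intro est) (auto simp: a_def)
        also have "\<dots> < M * (e\<^sup>2 / M)"
          using N[of i j] that m by (intro mult_strict_left_mono) (auto simp: dist_real_def)
        finally have "(norm (G (a i) x - G (a j) x))\<^sup>2 < e\<^sup>2"
          using m by simp
        then show ?thesis
          using e power2_less_imp_less[of "norm (G (a i) x - G (a j) x)" e] by (simp add: dist_norm)
      qed
      then have "dist (G (a i) x) (G (a j) x) < e" if "i \<ge> N" "j \<ge> N" for i j
        using that by (metis dist_commute nle_le)
      then show "\<exists>N. \<forall>i\<ge>N. \<forall>j\<ge>N. dist (G (a i) x) (G (a j) x) < e"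
        by blast
    qed
    then show ?thesis
      using Cauchy_convergent convergent_def by blast
  qed
  then obtain f where f: "\<And>x. (\<lambda>n. G (a n) x) \<longlonglongrightarrow> f x"
    by metis
  have "bounded_linear f"
  proof (rule bounded_linear_intro)
    show "f (x + y) = f x + f y" for x y
      by (rule LIMSEQ_unique[OF f]) (simp add: blinfun.bilinear_simps f tendsto_add)
    show "f (r *\<^sub>R x) = r *\<^sub>R f x" for x r
      by (rule LIMSEQ_unique[OF f]) (simp add: blinfun.bilinear_simps f tendsto_scaleR)
    fix x
    have "norm (G (a n) x) \<le> norm x * M" for n
      using op_box_norm_le[OF box[OF a(1,2)[of n]]] m norm_blinfun[of "G (a n)" x]
      by (metis less_imp_le mult.commute mult_left_mono norm_ge_zero order_trans)
    then show "norm (f x) \<le> norm x * M"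
      using LIMSEQ_le_const2[OF tendsto_norm[OF f[of x]]] by blast
  qed
  then have X: "blinfun_apply (Blinfun f) = f"
    by (rule bounded_linear_Blinfun_apply)
  have form: "(\<lambda>n. inner (G (a n) x) y) \<longlonglongrightarrow> inner (f x) y" for x y
    by (intro tendsto_intros f)
  have "Blinfun f \<in> self_adjoint"
    by (rule self_adjoint_weak_limit[of "\<lambda>n. G (a n)"])
      (simp_all add: X form op_box_self_adjoint[OF box[OF a]])
  moreover have "m * (norm x)\<^sup>2 \<le> inner (f x) x" for x
    using LIMSEQ_le_const[OF form] op_box_lower[OF box[OF a]] by blast
  moreover have "inner (f x) x \<le> M * (norm x)\<^sup>2" for x
    using LIMSEQ_le_const2[OF form] op_box_upper[OF box[OF a]] by blast
  ultimately have X_box: "Blinfun f \<in> op_box m M"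
    by (simp add: op_box_def X)
  have below: "inner (f x) x \<le> inner (G t x) x" if t: "0 < t" "t \<le> 1" for t x
  proof (rule LIMSEQ_le_const2[OF form])
    obtain N where "a N < t"
      using reals_Archimedean[OF t(1)] by (auto simp: a_def)
    then have "a n \<le> t" if "n \<ge> N" for n
      using that by (smt (verit) a_def le_imp_inverse_le of_nat_0_less_iff of_nat_le_iff zero_less_Suc Suc_le_mono)
    then show "\<exists>N. \<forall>n\<ge>N. inner (G (a n) x) x \<le> inner (G t x) x"
      using le a t by blast
  qed
  have "((\<lambda>t. G t x) \<longlongrightarrow> f x) (at_right 0)" for x
  proof (rule tendstoI)
    fix e :: real assume e: "0 < e"
    then have "0 < e\<^sup>2 / M"
      using m by simp
    then have "\<forall>\<^sub>F n in sequentially. dist (inner (G (a n) x) x) (inner (f x) x) < e\<^sup>2 / M"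
      using form tendstoD by blast
    then obtain n where n: "dist (inner (G (a n) x) x) (inner (f x) x) < e\<^sup>2 / M"
      unfolding eventually_sequentially by blast
    have "\<forall>\<^sub>F t in at_right 0. t \<in> {0<..<a n}"
      by (rule eventually_at_right_real[OF a(1)])
    then show "\<forall>\<^sub>F t in at_right 0. dist (G t x) (f x) < e"
    proof eventually_elim
      case (elim t)
      then have t: "0 < t" "t \<le> a n" "t \<le> 1"
        using a(2)[of n] by auto
      have "(norm (G t x - f x))\<^sup>2 \<le> M * (inner (G t x) x - inner (f x) x)"
        using norm_apply_le_form[OF op_box_diff[OF box[OF t(1,3)] X_box m(1)] m(2), of x] below[OF t(1,3)]
        by (simp add: X blinfun.bilinear_simps inner_simps)
      also have "\<dots> \<le> M * (inner (G (a n) x) x - inner (f x) x)"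
        using le[OF t(1,2) a(2)] m by (intro mult_left_mono) auto
      also have "\<dots> < M * (e\<^sup>2 / M)"
        using n m by (intro mult_strict_left_mono) (auto simp: dist_real_def)
      finally have "(norm (G t x - f x))\<^sup>2 < e\<^sup>2"
        using m by simp
      then show ?case
        using e power2_less_imp_less[of "norm (G t x - f x)" e] by (simp add: dist_norm)
    qed
  qed
  then show ?thesis
    using X_box by (intro bexI[of _ "Blinfun f"]) (simp_all add: limitin_strong_operator_topology X)
qed

section \<open>The integrated mean as a map on positive definite operators\<close>

definition mean_map ::
    "(real \<times> ('a::complex_hilbert \<Rightarrow>\<^sub>L 'a)) measure \<Rightarrow> real \<Rightarrow> ('a \<Rightarrow>\<^sub>L 'a) \<Rightarrow> ('a \<Rightarrow>\<^sub>L 'a)"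
  where "mean_map \<mu> t X = (THE T. has_weak_integral (\<lambda>(s, A). op_mean s t X A) T \<mu>)"

lemma mean_map_eqI:
  "has_weak_integral (\<lambda>(s, A). op_mean s t X A) T \<mu> \<Longrightarrow> mean_map \<mu> t X = T"
  unfolding mean_map_def using has_weak_integral_unique by blast

text \<open>
  The bounded support enters only through these bounds, which may be widened to include any given
  positive definite operator.
\<close>

locale bounded_measure =
  fixes \<mu> :: "(real \<times> ('a::complex_hilbert \<Rightarrow>\<^sub>L 'a)) measure" and m M :: real
  assumes sets_\<mu>: "sets \<mu> = sets (restrict_space borel ({0..1} \<times> pos_def))"
    and prob: "prob_space \<mu>"
    and AE_box: "AE \<omega> in \<mu>. snd \<omega> \<in> op_box m M"
    and m: "0 < m" "m \<le> M"

text \<open>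
  A nonmeasurable support would have measure \<open>0\<close>, so the support is measurable, of full measure.
\<close>

lemma prob_measures_bounded_measure:
  assumes "\<mu> \<in> prob_measures_01_pos_def"
  shows "\<exists>m M. bounded_measure \<mu> m M"
proof -
  obtain r where sets: "sets \<mu> = sets (restrict_space borel ({0..1} \<times> pos_def))"
    and prob: "prob_space \<mu>" and supp: "measure \<mu> (measure_supp \<mu>) = 1"
    and r: "measure_supp \<mu> \<subseteq> {0..1} \<times>
      {A. op_le (exp (- r) *\<^sub>R id_blinfun) A \<and> op_le A (exp r *\<^sub>R id_blinfun)}"
    using assms unfolding prob_measures_01_pos_def_def by blast
  interpret prob_space \<mu> by fact
  have space: "space \<mu> = {0..1} \<times> pos_def"
    using sets_eq_imp_space_eq[OF sets] by (simp add: space_restrict_space)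
  have "measure_supp \<mu> \<in> sets \<mu>"
    using supp measure_notin_sets by fastforce
  then have "AE \<omega> in \<mu>. \<omega> \<in> measure_supp \<mu>"
    using supp by (simp add: AE_in_set_eq_1)
  then have AE: "AE \<omega> in \<mu>. snd \<omega> \<in> op_box (exp (- \<bar>r\<bar>)) (exp \<bar>r\<bar>)"
    using AE_space
  proof eventually_elim
    case (elim \<omega>)
    then have "snd \<omega> \<in> op_box (exp (- r)) (exp r)"
      using r by (auto simp: op_box_iff_op_le space pos_def_self_adjoint)
    then show ?case
      by (rule op_box_mono) auto
  qed
  have "bounded_measure \<mu> (exp (- \<bar>r\<bar>)) (exp \<bar>r\<bar>)"
    using sets prob AE by unfold_locales auto
  then show ?thesis
    by blast
qed

context bounded_measure
begin

lemma M: "0 < M"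
  using m by simp

lemma box_pos_def: "X \<in> op_box m M \<Longrightarrow> X \<in> pos_def"
  using m M op_box_pos_def by blast

lemma widen:
  assumes "0 < m'" "m' \<le> m" "M \<le> M'"
  shows "bounded_measure \<mu> m' M'"
proof (rule bounded_measure.intro)
  show "AE \<omega> in \<mu>. snd \<omega> \<in> op_box m' M'"
    using AE_box by eventually_elim (rule op_box_mono[OF _ assms(2,3)])
  show "m' \<le> M'"
    using assms m by linarith
qed (rule sets_\<mu> prob assms(1))+

lemma widen_to_include:
  assumes "X \<in> pos_def"
  obtains m' M' where "bounded_measure \<mu> m' M'" "X \<in> op_box m' M'"
proof -
  obtain n N where N: "0 < n" "0 < N" "X \<in> op_box n N"
    using assms by (auto simp: pos_def_iff_op_box)
  then have "bounded_measure \<mu> (min m n) (max M N)" "X \<in> op_box (min m n) (max M N)"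
    using m by (auto intro!: widen intro: op_box_mono)
  then show ?thesis
    by (rule that)
qed

lemma space_\<mu>: "space \<mu> = {0..1} \<times> pos_def"
  using sets_eq_imp_space_eq[OF sets_\<mu>] by (simp add: space_restrict_space)

lemma AE_space_box: "AE \<omega> in \<mu>. fst \<omega> \<in> {0..1} \<and> snd \<omega> \<in> op_box m M \<and> snd \<omega> \<in> pos_def"
  using AE_box AE_space by eventually_elim (auto simp: space_\<mu>)

text \<open>
  In the form given by \<open>op_mean_eq_harm_mean\<close> the mean is norm continuous in \<open>(s, A)\<close>.
\<close>

lemma op_mean_measurable:
  assumes t: "0 < t" "t \<le> 1" and X: "X \<in> pos_def"
  shows "(\<lambda>\<omega>. inner (blinfun_apply (case \<omega> of (s, A) \<Rightarrow> op_mean s t X A) x) y) \<in> borel_measurable \<mu>"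
proof -
  let ?d = "\<lambda>\<omega> :: real \<times> ('a \<Rightarrow>\<^sub>L 'a). harm_weight (fst \<omega>) t"
  let ?W = "\<lambda>\<omega>. (1 - ?d \<omega>) *\<^sub>R op_inv X + ?d \<omega> *\<^sub>R op_inv (snd \<omega>)"
  let ?S = "{0..1} \<times> pos_def :: (real \<times> ('a \<Rightarrow>\<^sub>L 'a)) set"
  have d: "0 < ?d \<omega>" "?d \<omega> \<le> 1" if "\<omega> \<in> ?S" for \<omega>
    using harm_weight_bounds[of "fst \<omega>" t] that t by auto
  have "continuous_on ?S (\<lambda>\<omega>. op_inv (snd \<omega>))"
    by (rule continuous_on_compose2[OF continuous_on_op_inv]) (auto intro: continuous_intros)
  then have "continuous_on ?S ?W"
    by (intro continuous_intros)
  then have "continuous_on ?S (\<lambda>\<omega>. op_inv (?W \<omega>))"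
  proof (rule continuous_on_compose2[OF continuous_on_op_inv])
    show "?W ` ?S \<subseteq> pos_def"
    proof (rule image_subsetI)
      fix \<omega> assume "\<omega> \<in> ?S"
      then show "?W \<omega> \<in> pos_def"
        using d[of \<omega>] by (intro pos_def_convex op_inv_pos_def X) (auto simp: less_imp_le)
    qed
  qed
  then have "continuous_on ?S (\<lambda>\<omega>. (1 - t / ?d \<omega>) *\<^sub>R X + (t / ?d \<omega>) *\<^sub>R op_inv (?W \<omega>))"
    using d by (intro continuous_intros) (auto simp: less_imp_neq[symmetric])
  moreover have "(case \<omega> of (s, A) \<Rightarrow> op_mean s t X A)
      = (1 - t / ?d \<omega>) *\<^sub>R X + (t / ?d \<omega>) *\<^sub>R op_inv (?W \<omega>)" if "\<omega> \<in> ?S" for \<omega>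
    using that t X by (auto simp: op_mean_eq_harm_mean harm_mean_def)
  ultimately have "continuous_on ?S (\<lambda>\<omega>. case \<omega> of (s, A) \<Rightarrow> op_mean s t X A)"
    by (subst continuous_on_cong[OF refl]) auto
  then have "continuous_on ?S (\<lambda>\<omega>. inner (blinfun_apply (case \<omega> of (s, A) \<Rightarrow> op_mean s t X A) x) y)"
    by (intro continuous_intros bounded_linear.continuous_on[OF blinfun.bounded_linear_left])
  then show ?thesis
    unfolding measurable_cong_sets[OF sets_\<mu> refl] by (rule borel_measurable_continuous_on_restrict)
qed

lemma AE_op_mean_box:
  assumes "0 < t" "t \<le> 1" "X \<in> op_box m M"
  shows "AE \<omega> in \<mu>. (case \<omega> of (s, A) \<Rightarrow> op_mean s t X A) \<in> op_box m M"
  using AE_space_box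
proof eventually_elim
  case (elim \<omega>)
  then have "mean_parameters (fst \<omega>) t"
    using assms by unfold_locales auto
  then show ?case
    using mean_parameters.op_mean_op_box[of "fst \<omega>" t X m M "snd \<omega>"] assms(3) elim m M
    by (simp add: split_beta)
qed

lemma mean_map_box:
  assumes t: "0 < t" "t \<le> 1" and X: "X \<in> op_box m M"
  shows "has_weak_integral (\<lambda>(s, A). op_mean s t X A) (mean_map \<mu> t X) \<mu>"
    "mean_map \<mu> t X \<in> op_box m M"
proof -
  have "X \<in> pos_def"
    using X by (rule box_pos_def)
  then obtain T where T: "has_weak_integral (\<lambda>(s, A). op_mean s t X A) T \<mu>"
    using has_weak_integral_exists[OF prob op_mean_measurable[OF t] AE_op_mean_box[OF t X]] m M
    by auto
  then show "has_weak_integral (\<lambda>(s, A). op_mean s t X A) (mean_map \<mu> t X) \<mu>"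
    by (simp add: mean_map_eqI)
  then show "mean_map \<mu> t X \<in> op_box m M"
    by (rule has_weak_integral_op_box[OF prob _ AE_op_mean_box[OF t X]])
qed

lemma has_weak_integral_mean_map:
  assumes t: "0 < t" "t \<le> 1" and X: "X \<in> pos_def"
  shows "has_weak_integral (\<lambda>(s, A). op_mean s t X A) (mean_map \<mu> t X) \<mu>"
  by (rule widen_to_include[OF X]) (rule bounded_measure.mean_map_box(1)[OF _ t])

lemma mean_map_mono:
  assumes t: "0 < t" "t \<le> 1" and P: "X \<in> pos_def" "Y \<in> pos_def" and le: "op_le X Y"
  shows "op_le (mean_map \<mu> t X) (mean_map \<mu> t Y)"
proof (rule has_weak_integral_mono[OF has_weak_integral_mean_map[OF t P(1)] has_weak_integral_mean_map[OF t P(2)]])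
  show "AE \<omega> in \<mu>. op_le (case \<omega> of (s, A) \<Rightarrow> op_mean s t X A) (case \<omega> of (s, A) \<Rightarrow> op_mean s t Y A)"
    using AE_space_box
  proof eventually_elim
    case (elim \<omega>)
    then have "mean_parameters (fst \<omega>) t"
      using t by unfold_locales auto
    then show ?case
      using mean_parameters.op_mean_mono[OF _ P _ _ le op_le_refl] elim
      by (simp add: split_beta pos_def_self_adjoint)
  qed
qed

lemma mean_map_scale_le:
  assumes t: "0 < t" "t \<le> 1" and X: "X \<in> op_box m M" and r: "1 \<le> r"
  shows "op_le (mean_map \<mu> t (r *\<^sub>R X))
    ((1 + contraction_rate (m / M) t * (r - 1)) *\<^sub>R mean_map \<mu> t X)"
proof -
  have P: "X \<in> pos_def" "r *\<^sub>R X \<in> pos_def"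
    using box_pos_def[OF X] pos_def_scaleR[of X r] r by auto
  show ?thesis
  proof (rule has_weak_integral_mono[OF has_weak_integral_mean_map[OF t P(2)]
        has_weak_integral_scaleR[OF prob has_weak_integral_mean_map[OF t P(1)]]])
    show "AE \<omega> in \<mu>. op_le (case \<omega> of (s, A) \<Rightarrow> op_mean s t (r *\<^sub>R X) A)
      ((1 + contraction_rate (m / M) t * (r - 1)) *\<^sub>R (case \<omega> of (s, A) \<Rightarrow> op_mean s t X A))"
      using AE_space_box
    proof eventually_elim
      case (elim \<omega>)
      then have "mean_parameters (fst \<omega>) t"
        using t by unfold_locales auto
      then show ?case
        using op_mean_scale_le[OF _ X _ m r] elim by (simp add: split_beta)
    qed
  qed
qed

lemma mean_map_parameter_mono:
  assumes t: "0 < t" "t \<le> t'" "t' \<le> 1" and X: "X \<in> pos_def"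
  shows "op_le (mean_map \<mu> t X) ((1 - t / t') *\<^sub>R X + (t / t') *\<^sub>R mean_map \<mu> t' X)"
proof (rule has_weak_integral_mono[OF has_weak_integral_mean_map[OF _ _ X]
      has_weak_integral_affine[OF prob _ has_weak_integral_mean_map[OF _ _ X]]])
  show "AE \<omega> in \<mu>. op_le (case \<omega> of (s, A) \<Rightarrow> op_mean s t X A)
    ((1 - t / t') *\<^sub>R X + (t / t') *\<^sub>R (case \<omega> of (s, A) \<Rightarrow> op_mean s t' X A))"
    using AE_space_box
    by eventually_elim (use op_mean_parameter_mono[OF _ _ t X] in \<open>auto simp: split_beta\<close>)
qed (use t X in \<open>auto simp: self_adjoint_scaleR pos_def_self_adjoint\<close>)

section \<open>Comparison principle, existence and uniqueness of the induced mean\<close>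

text \<open>
  Start with some \<open>r \<ge> 1\<close> such that \<open>Y \<le> r X\<close>.  Applying the monotone mean map to \<open>Y \<le> k X\<close> gives
  \<open>Y \<le> (1 + \<theta> (k - 1)) X\<close> with a fixed \<open>\<theta> < 1\<close>, so the factor can be driven down to \<open>1\<close>.
\<close>

lemma mean_map_comparison:
  assumes t: "0 < t" "t \<le> 1" and P: "X \<in> pos_def" "Y \<in> pos_def"
    and sub: "op_le Y (mean_map \<mu> t Y)" and super: "op_le (mean_map \<mu> t X) X"
  shows "op_le Y X"
proof (rule widen_to_include[OF P(1)])
  fix m' M' assume bm: "bounded_measure \<mu> m' M'" and X: "X \<in> op_box m' M'"
  interpret w: bounded_measure \<mu> m' M' by fact
  define \<theta> where "\<theta> = contraction_rate (m' / M') t"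
  have \<theta>: "0 \<le> \<theta>" "\<theta> < 1"
    unfolding \<theta>_def using contraction_rate_bounds[of "m' / M'" t] w.m w.M t by auto
  obtain n N where N: "0 < N" "Y \<in> op_box n N"
    using P(2) by (auto simp: pos_def_iff_op_box)
  then have NY: "inner (Y x) x \<le> N * (norm x)\<^sup>2" for x
    using op_box_upper by blast
  define r where "r = max 1 (N / m')"
  have iter: "op_le Y ((1 + \<theta> ^ n * (r - 1)) *\<^sub>R X)" for n
  proof (induction n)
    case 0
    have "inner (Y x) x \<le> r * inner (X x) x" for x
    proof -
      have "inner (Y x) x \<le> (N / m') * (m' * (norm x)\<^sup>2)"
        using NY[of x] w.m by simp
      also have "\<dots> \<le> (N / m') * inner (X x) x"
        using op_box_lower[OF X] w.m N by (intro mult_left_mono) auto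
      also have "\<dots> \<le> r * inner (X x) x"
        using pos_def_inner_ge_0[OF P(1)] by (intro mult_right_mono) (auto simp: r_def)
      finally show ?thesis .
    qed
    then show ?case
      by (simp add: op_le_iff P pos_def_self_adjoint self_adjoint_scaleR blinfun.bilinear_simps)
  next
    case (Suc n)
    define k where "k = 1 + \<theta> ^ n * (r - 1)"
    have k: "1 \<le> k"
      using \<theta> by (simp add: k_def r_def)
    note sub
    also have "op_le (mean_map \<mu> t Y) (mean_map \<mu> t (k *\<^sub>R X))"
      using Suc.IH k by (intro mean_map_mono t P pos_def_scaleR) (auto simp: k_def)
    also have "op_le \<dots> ((1 + \<theta> * (k - 1)) *\<^sub>R mean_map \<mu> t X)"
      unfolding \<theta>_def by (rule w.mean_map_scale_le[OF t X k])
    also have "op_le \<dots> ((1 + \<theta> * (k - 1)) *\<^sub>R X)"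
      using \<theta> k by (intro op_le_scaleR super) auto
    also have "1 + \<theta> * (k - 1) = 1 + \<theta> ^ Suc n * (r - 1)"
      by (simp add: k_def)
    finally show ?case .
  qed
  have "inner (Y x) x \<le> inner (X x) x" for x
  proof -
    have "(\<lambda>n. (1 + \<theta> ^ n * (r - 1)) * inner (X x) x) \<longlonglongrightarrow> (1 + 0 * (r - 1)) * inner (X x) x"
      using \<theta> by (intro tendsto_intros LIMSEQ_power_zero) simp
    moreover have "inner (Y x) x \<le> (1 + \<theta> ^ n * (r - 1)) * inner (X x) x" for n
      using iter[of n]
      by (simp add: op_le_iff P pos_def_self_adjoint self_adjoint_scaleR blinfun.bilinear_simps)
    ultimately show ?thesis
      using LIMSEQ_le_const by fastforce
  qed
  then show ?thesis
    by (simp add: op_le_pos_def_iff P)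
qed

text \<open>
  The quadratic form of \<open>P - Q\<close> is bounded in modulus by that of \<open>U - L \<le> b L\<close>.  Closeness in the
  order thus becomes closeness in norm.
\<close>

lemma norm_diff_le_sandwich:
  assumes L: "L \<in> op_box m M" and sa: "U \<in> self_adjoint" "P \<in> self_adjoint" "Q \<in> self_adjoint"
    and le: "op_le L P" "op_le P U" "op_le L Q" "op_le Q U" "op_le U ((1 + b) *\<^sub>R L)" and b: "0 \<le> b"
  shows "norm (P - Q) \<le> b * M"
proof (rule self_adjoint_norm_le)
  fix x
  have forms: "inner (L x) x \<le> inner (P x) x" "inner (P x) x \<le> inner (U x) x"
    "inner (L x) x \<le> inner (Q x) x" "inner (Q x) x \<le> inner (U x) x"
    "inner (U x) x \<le> (1 + b) * inner (L x) x"
    using le by (simp_all add: op_le_iff sa op_box_self_adjoint[OF L] self_adjoint_scaleR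
        blinfun.bilinear_simps)
  have "b * inner (L x) x \<le> b * (M * (norm x)\<^sup>2)"
    by (intro mult_left_mono op_box_upper[OF L] b)
  then show "\<bar>inner ((P - Q) x) x\<bar> \<le> b * M * (norm x)\<^sup>2"
    using forms by (simp add: blinfun.bilinear_simps inner_simps algebra_simps abs_le_iff)
qed (use sa b M in \<open>auto simp: self_adjoint_diff\<close>)

text \<open>
  Iterate from the scalars \<open>M\<close> and \<open>m\<close>.  The upper iterates decrease, the lower ones increase, and
  \<open>U\<^sub>n \<le> (1 + \<theta>\<^sup>n (M/m - 1)) L\<^sub>n\<close> closes the gap between them in norm.  The common limit \<open>X\<close> is fixed
  because the mean map keeps it between \<open>L\<^sub>n\<^sub>+\<^sub>1\<close> and \<open>U\<^sub>n\<^sub>+\<^sub>1\<close>.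
\<close>

lemma mean_map_fixed_point:
  assumes t: "0 < t" "t \<le> 1"
  shows "\<exists>X\<in>op_box m M. mean_map \<mu> t X = X"
proof -
  let ?F = "mean_map \<mu> t"
  define \<theta> where "\<theta> = contraction_rate (m / M) t"
  have \<theta>: "0 \<le> \<theta>" "\<theta> < 1"
    unfolding \<theta>_def using contraction_rate_bounds[of "m / M" t] m M t by auto
  define U where "U n = (?F ^^ n) (M *\<^sub>R id_blinfun)" for n
  define L where "L n = (?F ^^ n) (m *\<^sub>R id_blinfun)" for n
  have iterate: "U (Suc n) = ?F (U n)" "L (Suc n) = ?F (L n)" for n
    by (simp_all add: U_def L_def)
  have box: "U n \<in> op_box m M" "L n \<in> op_box m M" for n
  proof (induction n)
    case 0
    show "U 0 \<in> op_box m M" "L 0 \<in> op_box m M"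
      using id_op_box[of M, THEN op_box_mono] id_op_box[of m, THEN op_box_mono] m
      by (auto simp: U_def L_def)
  next
    case (Suc n)
    then show "U (Suc n) \<in> op_box m M" "L (Suc n) \<in> op_box m M"
      by (auto simp: iterate intro: mean_map_box(2)[OF t])
  qed
  have sa: "U n \<in> self_adjoint" "L n \<in> self_adjoint" for n
    by (rule op_box_self_adjoint[OF box(1)], rule op_box_self_adjoint[OF box(2)])
  note mono = mean_map_mono[OF t box_pos_def box_pos_def]
  have decr: "op_le (U (Suc n)) (U n)" and incr: "op_le (L n) (L (Suc n))" for n
  proof (induction n)
    case 0
    show "op_le (U (Suc 0)) (U 0)" "op_le (L 0) (L (Suc 0))"
      using box(1)[of "Suc 0"] box(2)[of "Suc 0"] by (auto simp: op_box_iff_op_le U_def L_def)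
  next
    case (Suc n)
    then show "op_le (U (Suc (Suc n))) (U (Suc n))" "op_le (L (Suc n)) (L (Suc (Suc n)))"
      using mono[OF box(1) box(1)] mono[OF box(2) box(2)] by (simp_all flip: iterate)
  qed
  have LU: "op_le (L n) (U n)" for n
  proof (induction n)
    case 0
    show ?case
      using box(1)[of 0] by (simp add: op_box_iff_op_le U_def L_def)
  next
    case (Suc n)
    then show ?case
      using mono[OF box(2) box(1)] by (simp flip: iterate)
  qed
  have UL: "op_le (U n) ((1 + \<theta> ^ n * (M / m - 1)) *\<^sub>R L n)" for n
  proof (induction n)
    case 0
    show ?case
      using m by (simp add: U_def L_def op_le_refl self_adjoint_intros)
  next
    case (Suc n)
    define k where "k = 1 + \<theta> ^ n * (M / m - 1)"
    have k: "1 \<le> k"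
      using \<theta> m by (simp add: k_def)
    have "op_le (U (Suc n)) (?F (k *\<^sub>R L n))"
      unfolding iterate(1)
      using Suc k by (intro mean_map_mono t box_pos_def box pos_def_scaleR) (auto simp: k_def)
    also have "op_le \<dots> ((1 + \<theta> * (k - 1)) *\<^sub>R ?F (L n))"
      unfolding \<theta>_def by (rule mean_map_scale_le[OF t box(2) k])
    finally show ?case
      by (simp add: k_def iterate mult.assoc)
  qed
  have U_decr: "op_le (U k) (U n)" if "n \<le> k" for n k
    using that by (induction rule: dec_induct) (auto intro: op_le_refl sa op_le_trans decr)
  have L_incr: "op_le (L n) (L k)" if "n \<le> k" for n k
    using that by (induction rule: dec_induct) (auto intro: op_le_refl sa op_le_trans incr)
  have L_le_U: "op_le (L n) (U k)" if "n \<le> k" for n k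
    using L_incr[OF that] LU[of k] by (rule op_le_trans)
  define c where "c = (M / m - 1) * M"
  have gap: "norm (P - Q) \<le> \<theta> ^ n * c"
    if "P \<in> self_adjoint" "Q \<in> self_adjoint" "op_le (L n) P" "op_le P (U n)" "op_le (L n) Q" "op_le Q (U n)" for P Q n
    using norm_diff_le_sandwich[OF box(2)[of n] sa(1)[of n] that UL[of n]] \<theta> m by (simp add: c_def mult.assoc)
  have tends: "(\<lambda>n. \<theta> ^ n * c) \<longlonglongrightarrow> 0"
    using tendsto_mult_right[OF LIMSEQ_power_zero[of \<theta>], of c] \<theta> by (simp add: mult.commute)
  have "Cauchy U"
  proof (rule metric_CauchyI)
    fix e :: real assume "0 < e"
    then have "\<forall>\<^sub>F n in sequentially. \<theta> ^ n * c < e / 2"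
      using order_tendstoD(2)[OF tends, of "e / 2"] by simp
    then obtain N where N: "\<theta> ^ N * c < e / 2"
      by (auto simp: eventually_sequentially)
    have "dist (U i) (U j) < e" if "N \<le> i" "N \<le> j" for i j
      using gap[of "U i" "U j" N] N \<open>0 < e\<close> that by (auto simp: dist_norm sa U_decr L_le_U)
    then show "\<exists>N. \<forall>i\<ge>N. \<forall>j\<ge>N. dist (U i) (U j) < e"
      by blast
  qed
  then obtain X where X: "U \<longlonglongrightarrow> X"
    using Cauchy_convergent convergent_def by blast
  have X_sa: "X \<in> self_adjoint"
    by (rule self_adjoint_limit[OF sa(1) X])
  have form: "(\<lambda>n. inner (U n x) x) \<longlonglongrightarrow> inner (X x) x" for x
    by (intro tendsto_intros X)
  have X_le: "op_le X (U n)" for n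
  proof -
    have "inner (X x) x \<le> inner (U n x) x" for x
      using U_decr[of n] by (intro LIMSEQ_le_const2[OF form] exI[of _ n]) (auto simp: op_le_iff sa)
    then show ?thesis
      by (simp add: op_le_iff sa X_sa)
  qed
  have le_X: "op_le (L n) X" for n
  proof -
    have "inner (L n x) x \<le> inner (X x) x" for x
      using L_le_U[of n] by (intro LIMSEQ_le_const[OF form] exI[of _ n]) (auto simp: op_le_iff sa)
    then show ?thesis
      by (simp add: op_le_iff sa X_sa)
  qed
  have X_box: "X \<in> op_box m M"
    using X_le[of 0] le_X[of 0] X_sa by (simp add: op_box_iff_op_le U_def L_def)
  have FX_box: "?F X \<in> op_box m M"
    by (rule mean_map_box(2)[OF t X_box])
  have "norm (?F X - X) \<le> \<theta> ^ Suc n * c" for n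
  proof (rule gap)
    show "op_le (L (Suc n)) (?F X)" "op_le (?F X) (U (Suc n))"
      unfolding iterate using mono[OF box(2) X_box le_X] mono[OF X_box box(1) X_le] .
  qed (use X_box FX_box X_le le_X op_box_self_adjoint in auto)
  then have "norm (?F X - X) \<le> 0"
    using LIMSEQ_le_const[OF LIMSEQ_Suc[OF tends]] by blast
  then show ?thesis
    using X_box by auto
qed

lemma induced_mean_fixed_point:
  assumes t: "0 < t" "t \<le> 1"
  shows "induced_mean t \<mu> \<in> op_box m M" "mean_map \<mu> t (induced_mean t \<mu>) = induced_mean t \<mu>"
proof -
  obtain X where X: "X \<in> op_box m M" "mean_map \<mu> t X = X"
    using mean_map_fixed_point[OF t] by blast
  have P: "X \<in> pos_def"
    using X(1) by (rule box_pos_def)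
  have "induced_mean t \<mu> = X"
    unfolding induced_mean_def
  proof (rule the_equality)
    show "X \<in> pos_def \<and> has_weak_integral (\<lambda>(s, A). op_mean s t X A) X \<mu>"
      using has_weak_integral_mean_map[OF t P] X(2) P by simp
    fix Y assume "Y \<in> pos_def \<and> has_weak_integral (\<lambda>(s, A). op_mean s t Y A) Y \<mu>"
    then have Y: "Y \<in> pos_def" "mean_map \<mu> t Y = Y"
      using mean_map_eqI by auto
    have "op_le Y X" "op_le X Y"
      using mean_map_comparison[OF t P Y(1)] mean_map_comparison[OF t Y(1) P] X(2) Y(2)
      by (simp_all add: op_le_refl pos_def_self_adjoint P Y(1))
    then have "inner ((Y - X) x) x = 0" for x
      by (simp add: op_le_pos_def_iff P Y(1) blinfun.bilinear_simps inner_simps eq_iff)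
    then have "norm (Y - X) \<le> 0"
      by (intro self_adjoint_norm_le) (auto simp: self_adjoint_diff pos_def_self_adjoint P Y(1))
    then show "Y = X"
      by simp
  qed
  then show "induced_mean t \<mu> \<in> op_box m M" "mean_map \<mu> t (induced_mean t \<mu>) = induced_mean t \<mu>"
    using X by simp_all
qed

text \<open>
  The mean \<open>X\<close> for the larger parameter \<open>t'\<close> is a supersolution for \<open>t\<close>: by
  \<open>mean_map_parameter_mono\<close>, the mean map for \<open>t\<close> sends it below \<open>(1 - t/t') X + (t/t') X = X\<close>.
\<close>

lemma induced_mean_mono:
  assumes t: "0 < t" "t \<le> t'" "t' \<le> 1"
  shows "op_le (induced_mean t \<mu>) (induced_mean t' \<mu>)"
proof -
  define X where "X = induced_mean t' \<mu>"
  define Y where "Y = induced_mean t \<mu>"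
  have X: "X \<in> pos_def" "mean_map \<mu> t' X = X" and Y: "Y \<in> pos_def" "mean_map \<mu> t Y = Y"
    using induced_mean_fixed_point[of t] induced_mean_fixed_point[of t'] t
    by (auto simp: X_def Y_def intro: box_pos_def)
  have "op_le (mean_map \<mu> t X) X"
    using mean_map_parameter_mono[OF t X(1)] by (simp add: X(2) flip: scaleR_add_left)
  moreover have "op_le Y (mean_map \<mu> t Y)"
    by (simp add: Y op_le_refl pos_def_self_adjoint)
  ultimately have "op_le Y X"
    using t by (intro mean_map_comparison[OF _ _ X(1) Y(1)]) auto
  then show ?thesis
    by (simp add: X_def Y_def)
qed

end

section \<open>Convergence of the induced means\<close>

theorem theorem6p3:
  fixes \<mu> :: "(real \<times> ('a::complex_hilbert \<Rightarrow>\<^sub>L 'a)) measure"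
  assumes "\<mu> \<in> prob_measures_01_pos_def"
  shows "\<exists>X\<^sub>0\<in>pos_def.
    limitin strong_operator_topology (\<lambda>t. induced_mean t \<mu>) X\<^sub>0 (at_right 0)"
proof -
  obtain m M where "bounded_measure \<mu> m M"
    using prob_measures_bounded_measure[OF assms] by blast
  then interpret bounded_measure \<mu> m M .
  obtain X where "X \<in> op_box m M" "limitin strong_operator_topology (\<lambda>t. induced_mean t \<mu>) X (at_right 0)"
    using monotone_strong_limit[of "\<lambda>t. induced_mean t \<mu>" m M] induced_mean_fixed_point(1)
      induced_mean_mono m M by auto
  then show ?thesis
    using box_pos_def by blast
qed

end
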